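(* Let $c\ge 0$. There is a constant $C_c$, depending only on $c$, such that for all real $T,z\ge 2$ and all complex sequences $(a_n)_{n\ge1}$, $(b_m)_{m\ge1}$ with $|a_n|,|b_m|\le 1$, \[ \Bigg|\sum_{\substack{n,m \text{ odd, square-free}\\ z<n\le T,\ z<m\le T\\ nm\le T}} (nm)^c a_n b_m \Big(\frac{n}{m}\Big)\Bigg|\le C_c\,\frac{T^{1+c}\log T}{z^{1/4}}. \]
   Context: $\big(\frac{n}{m}\big)$ denotes the Jacobi symbol, defined for integers $n$ and odd positive integers $m$. The sum runs over pairs $(n,m)$ of positive integers that are both odd and square-free. *)

theory Defs
  imports Complex_Main "HOL-Number_Theory.Number_Theory" "HOL-Computational_Algebra.Squarefree"
begin

text \<open>
  The Jacobi symbol as the product of Legendre symbols over the prime factors of the modulus,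
  with multiplicity. It is meaningful for odd positive m only, and \<open>jacobi n 1 = 1\<close>.
\<close>

definition jacobi :: "int \<Rightarrow> nat \<Rightarrow> int" where
  "jacobi n m = (\<Prod>p\<in>#prime_factorization m. Legendre n (int p))"

definition odd_squarefree_pairs :: "real \<Rightarrow> real \<Rightarrow> (nat \<times> nat) set" where
  "odd_squarefree_pairs T z =
     {(n, m). odd n \<and> squarefree n \<and> odd m \<and> squarefree m \<and>
              z < real n \<and> real n \<le> T \<and> z < real m \<and> real m \<le> T \<and> real n * real m \<le> T}"

end

theory Submission
  imports Defs "HOL-Analysis.Convex"
begin

text \<open>
  By Jacobi reciprocity one may assume \<open>m \<le> sqrt T\<close>; cut the range of \<open>m\<close> into dyadic blocks
  \<open>M \<le> m < 2 M\<close> and let \<open>N = T / M \<ge> M\<close>, so that \<open>n \<le> N\<close>. By Cauchy--Schwarz over \<open>m\<close>, the square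
  of the sum over a block is at most \<open>M\<close> times the sum over pairs \<open>n1, n2 \<le> N\<close> of
  \<open>\<bar>\<Sum>m. jacobi (n1 * n2) m\<bar>\<close>, where \<open>m\<close> runs over an initial segment of the block depending on
  \<open>max n1 n2\<close>. The product \<open>\<nu> = n1 * n2\<close> is a variable of length \<open>N\<^sup>2\<close>, and the second moment of its number
  of representations, the multiplicative energy of \<open>{1..N}\<close>, is \<open>O(N\<^sup>2 log N)\<close>. For square-free odd
  \<open>m\<close> the Jacobi symbol is a primitive character, so expanding it in additive characters with reduced
  frequencies \<open>a / m\<close> and applying the additive large sieve gives
  \<open>\<Sum>\<nu>\<le>N\<^sup>2. (\<Sum>m. jacobi \<nu> m)\<^sup>2 = O(N\<^sup>2 M)\<close>. The
  Rademacher--Menshov inequality makes this uniform over initial segments, which absorbs the condition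
  \<open>n m \<le> T\<close> at the cost of two logarithms. A second Cauchy--Schwarz bounds the fourth power of
  a block by \<open>O(M\<^sup>3 N\<^sup>4 (log T)\<^sup>3)\<close>, and the resulting bounds
  \<open>O(T log T / M powr (1/4))\<close> are summed over \<open>M > z / 2\<close>.
\<close>

section \<open>The Jacobi symbol\<close>

lemma Legendre_cases: "Legendre a p = 0 \<or> Legendre a p = 1 \<or> Legendre a p = -1"
  by (simp add: Legendre_def)

lemma Legendre_cong: "[a = b] (mod p) \<Longrightarrow> Legendre a p = Legendre b p"
  by (simp add: Legendre_def QuadRes_def cong_def)

lemma Legendre_mult:
  fixes p :: nat
  assumes "prime p" "odd p"
  shows "Legendre (a * b) p = Legendre a p * Legendre b p"
proof -
  have p2: "2 < p" using assms prime_ge_2_nat[of p] by (cases "p = 2") auto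
  note e = euler_criterion[OF assms(1) p2]
  have "[Legendre (a * b) p = (a * b) ^ ((p - 1) div 2)] (mod int p)" by (rule e)
  moreover have "[Legendre a p * Legendre b p = a ^ ((p - 1) div 2) * b ^ ((p - 1) div 2)] (mod int p)"
    by (intro cong_mult e)
  ultimately have "[Legendre (a * b) p = Legendre a p * Legendre b p] (mod int p)"
    by (metis cong_trans cong_sym power_mult_distrib)
  then have d: "int p dvd Legendre (a * b) p - Legendre a p * Legendre b p"
    by (simp add: cong_iff_dvd_diff)
  have "\<bar>Legendre (a * b) p - Legendre a p * Legendre b p\<bar> \<le> 2"
    using Legendre_cases[of "a*b" p] Legendre_cases[of a p] Legendre_cases[of b p] by auto
  then show ?thesis using d p2 zdvd_imp_le[of "int p" "\<bar>Legendre (a * b) p - Legendre a p * Legendre b p\<bar>"]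
    by (cases "Legendre (a * b) p - Legendre a p * Legendre b p = 0") auto
qed

lemma jacobi_1_right [simp]: "jacobi a 1 = 1" "jacobi a (Suc 0) = 1"
  by (simp_all add: jacobi_def)

lemma jacobi_prime: "prime p \<Longrightarrow> jacobi a p = Legendre a (int p)"
  by (simp add: jacobi_def prime_factorization_prime)

lemma jacobi_mult_right:
  "m > 0 \<Longrightarrow> n > 0 \<Longrightarrow> jacobi a (m * n) = jacobi a m * jacobi a n"
  by (simp add: jacobi_def prime_factorization_mult)

lemma abs_jacobi_le_1: "\<bar>jacobi a m\<bar> \<le> 1"
proof -
  have "\<bar>\<Prod>p\<in>#A. Legendre a (int p)\<bar> \<le> 1" for A
  proof (induction A)
    case (add p A)
    then show ?case using Legendre_cases[of a "int p"] by (auto simp: abs_mult)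
  qed auto
  then show ?thesis by (simp add: jacobi_def)
qed

lemma jacobi_mult_left:
  assumes "odd m"
  shows "jacobi (a * b) m = jacobi a m * jacobi b m"
proof -
  have "jacobi (a * b) m = (\<Prod>p\<in>#prime_factorization m. Legendre a (int p) * Legendre b (int p))"
    unfolding jacobi_def
  proof (rule arg_cong[where f = prod_mset], rule image_mset_cong)
    fix p assume "p \<in># prime_factorization m"
    then have "prime p" "p dvd m" by auto
    then show "Legendre (a * b) (int p) = Legendre a (int p) * Legendre b (int p)"
      using assms by (intro Legendre_mult) auto
  qed
  then show ?thesis by (simp add: jacobi_def prod_mset.distrib)
qed

lemma jacobi_cong:
  assumes "[a = b] (mod int m)"
  shows "jacobi a m = jacobi b m"
  unfolding jacobi_def
proof (rule arg_cong[where f = prod_mset], rule image_mset_cong)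
  fix p assume "p \<in># prime_factorization m"
  then have "int p dvd int m" by (simp add: in_prime_factors_imp_dvd)
  then have "[a = b] (mod int p)" using assms cong_dvd_modulus by blast
  then show "Legendre a (int p) = Legendre b (int p)" by (rule Legendre_cong)
qed

lemma Legendre_1: assumes "prime p" shows "Legendre 1 (int p) = 1"
proof -
    have "p > 1" using assms by (rule prime_gt_1_nat)
    then have 1: "\<not> [1 = 0] (mod int p)"
      by (simp add: cong_def)
    have 2: "QuadRes (int p) 1"
      unfolding QuadRes_def by (rule exI[of _ 1]) auto
    show ?thesis using 1 2 by (simp add: Legendre_def)
qed
lemma jacobi_1_left: "jacobi 1 m = 1"
proof -
  have "image_mset (\<lambda>p. Legendre 1 (int p)) (prime_factorization m) = image_mset (\<lambda>p. 1) (prime_factorization m)"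
    by (rule image_mset_cong) (auto intro: Legendre_1)
  then show ?thesis unfolding jacobi_def by simp
qed

text \<open>Squaring is not injective on residues, as 1 and \<open>p - 1\<close> have the same
  square, so on this finite set it is not surjective either; any residue that it misses is a
  witness.\<close>

lemma ex_quadratic_nonresidue:
  fixes p :: nat
  assumes "prime p" "odd p"
  obtains a where "Legendre a (int p) = -1"
proof -
  have p2: "2 < p" using assms prime_ge_2_nat[of p] by (cases "p = 2") auto
  define f where "f x = x ^ 2 mod int p" for x
  have sub: "f ` {0..<int p} \<subseteq> {0..<int p}" using p2 by (auto simp: f_def)
  have "f 1 = f (int p - 1)"
  proof -
    have "(int p - 1) ^ 2 = 1 + (int p - 2) * int p" by (simp add: power2_eq_square algebra_simps)
    then show ?thesis unfolding f_def by simp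
  qed
  then have "\<not> inj_on f {0..<int p}" using p2 inj_onD[of f "{0..<int p}" 1 "int p - 1"] by auto
  then have "f ` {0..<int p} \<noteq> {0..<int p}" using eq_card_imp_inj_on[of "{0..<int p}" f] by auto
  then obtain a where a: "a \<in> {0..<int p}" "a \<notin> f ` {0..<int p}" using sub by blast
  have "f 0 = 0" by (simp add: f_def)
  then have "a \<noteq> 0" using a p2 image_eqI[of 0 f 0] by force
  then have n0: "\<not> [a = 0] (mod int p)" using a by (simp add: cong_def)
  have "\<not> QuadRes (int p) a"
  proof
    assume "QuadRes (int p) a"
    then obtain y where "[y ^ 2 = a] (mod int p)" by (auto simp: QuadRes_def)
    then have "f (y mod int p) = a" using a unfolding f_def cong_def by (simp add: power_mod)
    moreover have "y mod int p \<in> {0..<int p}" using p2 by auto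
    ultimately show False using a by blast
  qed
  with n0 have "Legendre a (int p) = -1" by (simp add: Legendre_def)
  then show ?thesis using that by blast
qed

text \<open>The Chinese remainder theorem glues a nonresidue modulo \<open>p\<close> to 1 modulo
  \<open>m div p\<close>; square-freeness makes the two moduli coprime. Such a \<open>u\<close> is
  what forces Fourier coefficients at non-reduced frequencies to vanish.\<close>

lemma ex_jacobi_twist:
  assumes "odd m" "squarefree m" "prime p" "p dvd m"
  obtains u where "jacobi u m = -1" "[u = 1] (mod int (m div p))" "coprime u (int m)"
proof -
  define m' where "m' = m div p"
  have m: "m = p * m'" using assms by (simp add: m'_def)
  have "m > 0" using assms(1) by (cases m) auto
  then have pos: "p > 0" "m' > 0" using m by auto
  have "odd p" "odd m'" using assms m by auto
  have cop: "coprime p m'"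
  proof -
    have "\<not> p dvd m'"
    proof
      assume "p dvd m'"
      then have "p ^ 2 dvd m" using m by (simp add: power2_eq_square)
      then show False using squarefreeD[OF assms(2), of p] assms(3) by auto
    qed
    then show ?thesis using assms(3) by (simp add: prime_imp_coprime)
  qed
  obtain g where g: "Legendre g (int p) = -1" using ex_quadratic_nonresidue[OF assms(3) \<open>odd p\<close>] .
  obtain u where u: "[u = g] (mod int p)" "[u = 1] (mod int m')"
    using binary_chinese_remainder_int[of "int p" "int m'" g 1] cop by auto
  have "jacobi u m = jacobi u p * jacobi u m'" using m pos by (simp add: jacobi_mult_right)
  also have "jacobi u p = -1" using g assms(3) u(1) Legendre_cong[of u g "int p"] by (simp add: jacobi_prime)
  also have "jacobi u m' = 1" using u(2) jacobi_cong[of u 1 m'] jacobi_1_left[of m'] by simp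
  finally have 1: "jacobi u m = -1" by simp
  have "\<not> [g = 0] (mod int p)" using g by (auto simp: Legendre_def split: if_splits)
  then have "\<not> int p dvd u" using u(1) by (metis cong_0_iff cong_sym cong_trans)
  then have "coprime u (int p)" using assms(3)
    using prime_imp_coprime[of "int p" u] by (simp add: coprime_commute)
  moreover have "coprime u (int m')" using u(2) by (metis cong_imp_coprime cong_sym coprime_1_left)
  ultimately have "coprime u (int m)" using m by simp
  with 1 u(2) show ?thesis using that by (simp add: m'_def)
qed

section \<open>Quadratic reciprocity for the Jacobi symbol\<close>

definition recip_sign :: "nat \<Rightarrow> nat \<Rightarrow> int" where
  "recip_sign n m = (if n mod 4 = 3 \<and> m mod 4 = 3 then -1 else 1)"

text \<open>In its mod 4 form the reciprocity sign is multiplicative by a check of residues. This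
  lets reciprocity be built up one prime factor at a time.\<close>

lemma recip_sign_mult_left:
  assumes "odd a" "odd b"
  shows "recip_sign (a * b) m = recip_sign a m * recip_sign b m"
proof -
  have "a mod 4 = 1 \<or> a mod 4 = 3" "b mod 4 = 1 \<or> b mod 4 = 3" using assms by presburger+
  moreover have "(a * b) mod 4 = ((a mod 4) * (b mod 4)) mod 4" by (simp add: mod_mult_eq)
  ultimately show ?thesis by (auto simp: recip_sign_def)
qed

lemma recip_sign_commute: "recip_sign a b = recip_sign b a"
  by (auto simp: recip_sign_def)

lemma Legendre_recip:
  fixes p q :: nat
  assumes "prime p" "odd p" "prime q" "odd q"
  shows "Legendre p q = recip_sign p q * Legendre q p"
proof (cases "p = q")
  case True
  have "Legendre p p = 0" by (simp add: Legendre_def cong_def)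
  then show ?thesis using True by simp
next
  case False
  have p2: "2 < p" using assms prime_ge_2_nat[of p] by (cases "p = 2") auto
  have q2: "2 < q" using assms prime_ge_2_nat[of q] by (cases "q = 2") auto
  have *: "Legendre p q * Legendre q p = (-1::int) ^ ((p - 1) div 2 * ((q - 1) div 2))"
    using Quadratic_Reciprocity[OF assms(1) p2 assms(3) q2 False] .
  have odd4: "odd ((n - 1) div 2) \<longleftrightarrow> n mod 4 = 3" if "odd n" for n :: nat
    using that by presburger
  have "(-1::int) ^ ((p - 1) div 2 * ((q - 1) div 2)) = recip_sign p q"
    using odd4[OF assms(2)] odd4[OF assms(4)]
    unfolding recip_sign_def minus_one_power_iff by auto
  with * have "Legendre p q * Legendre q p = recip_sign p q" by simp
  \<comment> \<open>The product of the two symbols is a sign, so both are 1 or -1 and each is its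
    own inverse.\<close>
  then show ?thesis using Legendre_cases[of p q] Legendre_cases[of q p]
    by (auto simp: recip_sign_def split: if_splits)
qed

text \<open>Induction over the prime factors of \<open>n\<close>, with \<open>Legendre_recip\<close>
  for each of them. The same induction in the other argument then gives \<open>jacobi_recip\<close>,
  with this lemma as its prime step.\<close>

lemma jacobi_recip_prime:
  fixes p n :: nat
  assumes "prime p" "odd p" "odd n"
  shows "jacobi p n = recip_sign p n * jacobi n p"
  using assms(3)
proof (induction n rule: prime_divisors_induct)
  case (factor q n)
  then have o: "odd q" "odd n" by auto
  have "q > 0" "n > 0" using o by (auto simp: odd_pos)
  have "jacobi p (q * n) = jacobi p q * jacobi p n"
    using \<open>q > 0\<close> \<open>n > 0\<close> by (rule jacobi_mult_right)
  also have "jacobi p q = recip_sign p q * jacobi q p"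
    using Legendre_recip[OF assms(1,2) _ o(1)] assms factor.hyps by (simp add: jacobi_prime)
  also have "jacobi p n = recip_sign p n * jacobi n p" using factor o by simp
  also have "recip_sign p q * jacobi q p * (recip_sign p n * jacobi n p) =
     recip_sign p (q * n) * jacobi (q * n) p"
    using recip_sign_mult_left[OF o, of p] jacobi_mult_left[OF assms(2), of q n]
    by (simp add: recip_sign_commute[of p])
  finally show ?case by simp
qed (use assms in \<open>auto simp: recip_sign_def jacobi_1_left\<close>)

lemma jacobi_recip:
  fixes m n :: nat
  assumes "odd m" "odd n"
  shows "jacobi n m = recip_sign n m * jacobi m n"
  using assms(2)
proof (induction n rule: prime_divisors_induct)
  case (factor q n)
  then have o: "odd q" "odd n" by auto
  have "q > 0" "n > 0" using o by (auto simp: odd_pos)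
  have "jacobi (q * n) m = jacobi q m * jacobi n m"
    using jacobi_mult_left[OF assms(1), of q n] by simp
  also have "jacobi q m = recip_sign q m * jacobi m q"
    using assms factor.hyps o by (intro jacobi_recip_prime) auto
  also have "jacobi n m = recip_sign n m * jacobi m n" using factor o by simp
  also have "recip_sign q m * jacobi m q * (recip_sign n m * jacobi m n) =
     recip_sign (q * n) m * jacobi m (q * n)"
    using recip_sign_mult_left[OF o, of m] \<open>q > 0\<close> \<open>n > 0\<close> by (simp add: jacobi_mult_right)
  finally show ?case .
qed (use assms in \<open>auto simp: recip_sign_def jacobi_1_left\<close>)

section \<open>The additive large sieve\<close>

lemma abs_sin_ge:
  fixes x :: real
  assumes "\<bar>x\<bar> \<le> pi / 2"
  shows "\<bar>x\<bar> / 3 \<le> \<bar>sin x\<bar>"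
proof -
  have "\<bar>sin x - (\<Sum>m<3. sin_coeff m * x ^ m)\<bar> \<le> inverse (fact 3) * \<bar>x\<bar> ^ 3"
    by (rule Maclaurin_sin_bound)
  then have "\<bar>sin x - x\<bar> \<le> \<bar>x\<bar> ^ 3 / 6"
    by (simp add: numeral_eq_Suc sin_coeff_def field_simps)
  \<comment> \<open>Since \<open>\<bar>x\<bar>\<close> is at most 2, the cubic Taylor error is at
    most two thirds of \<open>\<bar>x\<bar>\<close>, which leaves the constant 1/3.\<close>
  moreover have "\<bar>x\<bar> ^ 3 / 6 \<le> \<bar>x\<bar> * (2 / 3)"
  proof -
    have "\<bar>x\<bar> \<le> 2" using assms pi_less_4 by linarith
    then have "\<bar>x\<bar> ^ 2 \<le> 2 ^ 2" by (intro power_mono) auto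
    then have "\<bar>x\<bar> * \<bar>x\<bar> ^ 2 \<le> \<bar>x\<bar> * 4" by (intro mult_left_mono) auto
    then show ?thesis by (simp add: power3_eq_cube power2_eq_square)
  qed
  ultimately show ?thesis by linarith
qed

lemma norm_cis_minus_1_ge:
  assumes "\<bar>t\<bar> \<le> 1 / 2"
  shows "\<bar>t\<bar> \<le> norm (cis (2 * pi * t) - 1)"
proof -
  have "cis (2 * pi * t) - 1 = cis (pi * t) * (cis (pi * t) - cis (- (pi * t)))"
    by (simp add: cis_mult algebra_simps)
  also have "cis (pi * t) - cis (- (pi * t)) = of_real (2 * sin (pi * t)) * \<i>"
    by (simp add: complex_eq_iff)
  finally have "norm (cis (2 * pi * t) - 1) = 2 * \<bar>sin (pi * t)\<bar>"
    by (simp add: norm_mult)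
  moreover have "\<bar>pi * t\<bar> / 3 \<le> \<bar>sin (pi * t)\<bar>"
    using assms mult_left_mono[of "\<bar>t\<bar>" "1/2" pi] by (intro abs_sin_ge) (auto simp: abs_mult)
  moreover have "2 * \<bar>t\<bar> \<le> \<bar>pi * t\<bar>"
    using mult_right_mono[of 2 pi "\<bar>t\<bar>"] pi_ge_two by (simp add: abs_mult)
  ultimately show ?thesis by linarith
qed

text \<open>A one-sided Dirichlet kernel; its squared modulus is \<open>K\<close> times the Fejer
  kernel.\<close>

definition exp_sum :: "nat \<Rightarrow> real \<Rightarrow> complex" where
  "exp_sum K t = (\<Sum>i<K. cis (2 * pi * real i * t))"

lemma norm_exp_sum_le: "norm (exp_sum K t) \<le> K"
  unfolding exp_sum_def using norm_sum[of "\<lambda>i. cis (2 * pi * real i * t)" "{..<K}"] by simp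

lemma exp_sum_minus_int: "exp_sum K (t - of_int k) = exp_sum K t"
proof -
  have "cis (2 * pi * real i * (t - of_int k)) = cis (2 * pi * real i * t)" for i
  proof -
    have "2 * pi * real i * (t - of_int k) = 2 * pi * real i * t - 2 * pi * of_int (int i * k)"
      by (simp add: algebra_simps)
    then show ?thesis
      by (simp only: cis_divide[symmetric] cis_multiple_2pi Ints_of_int div_by_1)
  qed
  then show ?thesis by (simp add: exp_sum_def)
qed

lemma exp_sum_uminus: "exp_sum K (- t) = cnj (exp_sum K t)"
  by (simp add: exp_sum_def cis_cnj)

lemma norm_exp_sum_le_inverse:
  assumes "\<bar>t\<bar> \<le> 1 / 2" "t \<noteq> 0"
  shows "norm (exp_sum K t) \<le> 2 / \<bar>t\<bar>"
proof -
  define z where "z = cis (2 * pi * t)"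
  have z1: "\<bar>t\<bar> \<le> norm (z - 1)" unfolding z_def by (rule norm_cis_minus_1_ge[OF assms(1)])
  then have "z \<noteq> 1" using assms(2) by auto
  have "exp_sum K t = (\<Sum>i<K. z ^ i)"
    by (simp add: exp_sum_def z_def DeMoivre mult_ac)
  also have "\<dots> = (z ^ K - 1) / (z - 1)" using \<open>z \<noteq> 1\<close> by (rule geometric_sum)
  finally have "norm (exp_sum K t) = norm (z ^ K - 1) / norm (z - 1)" by (simp add: norm_divide)
  also have "norm (z ^ K - 1) \<le> norm (z ^ K) + norm (1::complex)" by (rule norm_triangle_ineq4)
  also have "norm (z ^ K) + norm (1::complex) = 2" by (simp add: z_def norm_power)
  finally have "norm (exp_sum K t) \<le> 2 / norm (z - 1)" by (simp add: divide_right_mono)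
  also have "\<dots> \<le> 2 / \<bar>t\<bar>" using z1 assms(2) \<open>z \<noteq> 1\<close> by (intro divide_left_mono) auto
  finally show ?thesis .
qed

lemma exp_sum_mult_cnj:
  "exp_sum K t * cnj (exp_sum K t) = (\<Sum>i<K. \<Sum>j<K. cis (2 * pi * (real i - real j) * t))"
  by (simp add: exp_sum_def sum_product cis_cnj cis_mult algebra_simps)

lemma sum_inverse_square_nat_le: "(\<Sum>k=1..Suc n. 1 / real k ^ 2) \<le> 2 - 1 / real (Suc n)"
proof (induction n)
  case (Suc n)
  have "1 / real (Suc (Suc n)) ^ 2 \<le> 1 / (real (Suc n) * real (Suc (Suc n)))"
    unfolding power2_eq_square by (intro divide_left_mono mult_right_mono) auto
  also have "\<dots> = 1 / real (Suc n) - 1 / real (Suc (Suc n))"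
    by (simp add: field_simps)
  finally show ?case using Suc by simp
qed simp

lemma sum_inverse_square_int_le:
  fixes A :: "int set"
  assumes "finite A" "0 \<notin> A"
  shows "(\<Sum>k\<in>A. 1 / of_int k ^ 2) \<le> (4 :: real)"
proof -
  have pos: "(\<Sum>k\<in>B. 1 / real_of_int k ^ 2) \<le> 2" if "finite B" "\<And>k. k \<in> B \<Longrightarrow> k > 0" for B :: "int set"
  proof -
    define n where "n = nat (Max (insert 1 B))"
    have "k \<le> int n" if "k \<in> B" for k
    proof -
      have "k \<le> Max (insert 1 B)" using that \<open>finite B\<close> by (intro Max_ge) auto
      then show ?thesis by (simp add: n_def)
    qed
    then have sub: "nat ` B \<subseteq> {1..Suc n}" using that by force
    have "(\<Sum>k\<in>B. 1 / real_of_int k ^ 2) = (\<Sum>k\<in>nat ` B. 1 / real k ^ 2)"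
      using that by (subst sum.reindex) (auto simp: inj_on_def less_imp_le nat_eq_iff2 intro!: sum.cong)
    also have "\<dots> \<le> (\<Sum>k=1..Suc n. 1 / real k ^ 2)"
      using sub by (intro sum_mono2) auto
    also have "\<dots> \<le> 2 - 1 / real (Suc n)" by (rule sum_inverse_square_nat_le)
    also have "\<dots> \<le> 2" by simp
    finally show ?thesis .
  qed
  have "k > 0 \<or> k < 0" if "k \<in> A" for k using that assms(2) by (cases "k = 0") auto
  then have "A = {k\<in>A. k > 0} \<union> {k\<in>A. k < 0}" by blast
  then have "(\<Sum>k\<in>A. 1 / of_int k ^ 2) = (\<Sum>k\<in>{k\<in>A. k > 0} \<union> {k\<in>A. k < 0}. 1 / real_of_int k ^ 2)"
    by simp
  also have "\<dots> = (\<Sum>k\<in>{k\<in>A. k > 0}. 1 / real_of_int k ^ 2) + (\<Sum>k\<in>{k\<in>A. k < 0}. 1 / real_of_int k ^ 2)"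
    using assms by (intro sum.union_disjoint) auto
  also have "(\<Sum>k\<in>{k\<in>A. k < 0}. 1 / real_of_int k ^ 2) = (\<Sum>k\<in>uminus ` {k\<in>A. k < 0}. 1 / real_of_int k ^ 2)"
    by (subst sum.reindex) auto
  also have "(\<Sum>k\<in>{k\<in>A. k > 0}. 1 / real_of_int k ^ 2) + (\<Sum>k\<in>uminus ` {k\<in>A. k < 0}. 1 / real_of_int k ^ 2) \<le> 2 + 2"
    using assms by (intro add_mono pos) auto
  finally show ?thesis by simp
qed

text \<open>Reduce each difference to a representative \<open>t s\<close> in [-1/2, 1/2] and round
  \<open>t s / \<delta>\<close> to an integer \<open>k s\<close>. Spacing makes these labels nonzero
  and distinct for \<open>s\<close> other than \<open>r\<close>, and rounding gives
  \<open>\<bar>t s\<bar> \<ge> \<delta> * \<bar>k s\<bar> / 2\<close>. The geometric-series bound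
  then makes each off-diagonal term at most \<open>16 / (\<delta> * k s)\<^sup>2\<close>, and a sum
  of inverse squares of distinct nonzero integers is at most 4.\<close>

lemma sum_norm_exp_sum_spaced_le:
  fixes \<theta> :: "'a \<Rightarrow> real"
  assumes "finite R" "\<delta> > 0" "r \<in> R"
    and spaced: "\<And>r s k. r \<in> R \<Longrightarrow> s \<in> R \<Longrightarrow> r \<noteq> s \<Longrightarrow> \<delta> \<le> \<bar>\<theta> r - \<theta> s - of_int k\<bar>"
  shows "(\<Sum>s\<in>R. norm (exp_sum K (\<theta> r - \<theta> s)) ^ 2) \<le> real K ^ 2 + 64 / \<delta> ^ 2"
proof -
  define t where "t s = \<theta> r - \<theta> s - of_int (round (\<theta> r - \<theta> s))" for s
  define k where "k s = round (t s / \<delta>)" for s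
  have t_le: "\<bar>t s\<bar> \<le> 1 / 2" for s
    unfolding t_def using of_int_round_abs_le[of "\<theta> r - \<theta> s"] by (simp add: abs_minus_commute)
  have k_near: "\<bar>t s / \<delta> - of_int (k s)\<bar> \<le> 1 / 2" for s
    unfolding k_def using of_int_round_abs_le[of "t s / \<delta>"] by (simp add: abs_minus_commute)
  have t_ge: "1 \<le> \<bar>t s / \<delta>\<bar>" if "s \<in> R" "s \<noteq> r" for s
    using spaced[OF assms(3) that(1) that(2)[symmetric], of "round (\<theta> r - \<theta> s)"] \<open>\<delta> > 0\<close>
    by (simp add: t_def field_simps)
  have k_ne0: "k s \<noteq> 0" if "s \<in> R" "s \<noteq> r" for s
  proof
    assume "k s = 0"
    then have "\<bar>t s / \<delta>\<bar> \<le> 1 / 2" using k_near[of s] by (simp only: of_int_0 diff_0_right)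
    then show False using t_ge[OF that] by linarith
  qed
  have "inj_on k (R - {r})"
  proof (rule inj_onI, rule ccontr)
    fix s s' assume s: "s \<in> R - {r}" "s' \<in> R - {r}" and eq: "k s = k s'" and "s \<noteq> s'"
    define l where "l = round (\<theta> r - \<theta> s') - round (\<theta> r - \<theta> s)"
    have "\<delta> \<le> \<bar>\<theta> s' - \<theta> s - of_int (- l)\<bar>"
      using s \<open>s \<noteq> s'\<close> by (intro spaced) auto
    also have "\<theta> s' - \<theta> s - of_int (- l) = t s - t s'" by (simp add: t_def l_def)
    finally have "1 \<le> \<bar>t s / \<delta> - t s' / \<delta>\<bar>" using \<open>\<delta> > 0\<close> by (simp add: field_simps diff_divide_distrib[symmetric])
    \<comment> \<open>The reals with a given rounding form a half-open interval of length 1, so two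
      of them differ by strictly less than 1.\<close>
    then show False
      using of_int_round_gt[of "t s / \<delta>"] of_int_round_le[of "t s / \<delta>"]
        of_int_round_gt[of "t s' / \<delta>"] of_int_round_le[of "t s' / \<delta>"] eq
      unfolding k_def by linarith
  qed
  have single: "norm (exp_sum K (\<theta> r - \<theta> s)) ^ 2 \<le> 16 / \<delta> ^ 2 * (1 / of_int (k s) ^ 2)"
    if s: "s \<in> R - {r}" for s
  proof -
    have "1 \<le> \<bar>k s\<bar>" using k_ne0[of s] s by auto
    then have "1 \<le> \<bar>real_of_int (k s)\<bar>" by linarith
    then have "\<bar>real_of_int (k s)\<bar> / 2 \<le> \<bar>t s / \<delta>\<bar>" using k_near[of s] by linarith
    then have *: "\<delta> * \<bar>real_of_int (k s)\<bar> / 2 \<le> \<bar>t s\<bar>"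
      using \<open>\<delta> > 0\<close> by (simp add: field_simps)
    have pos: "0 < \<delta> * \<bar>real_of_int (k s)\<bar> / 2" using \<open>1 \<le> \<bar>real_of_int (k s)\<bar>\<close> \<open>\<delta> > 0\<close> by auto
    have "norm (exp_sum K (\<theta> r - \<theta> s)) = norm (exp_sum K (t s))"
      by (simp add: t_def exp_sum_minus_int)
    also have "\<dots> \<le> 2 / \<bar>t s\<bar>" using t_le * pos by (intro norm_exp_sum_le_inverse) auto
    also have "\<dots> \<le> 2 / (\<delta> * \<bar>real_of_int (k s)\<bar> / 2)"
      using * pos by (intro divide_left_mono mult_pos_pos) auto
    also have "\<dots> = 4 / (\<delta> * \<bar>real_of_int (k s)\<bar>)" by simp
    finally have "norm (exp_sum K (\<theta> r - \<theta> s)) ^ 2 \<le> (4 / (\<delta> * \<bar>real_of_int (k s)\<bar>)) ^ 2"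
      by (intro power_mono) auto
    also have "\<dots> = 16 / \<delta> ^ 2 * (1 / of_int (k s) ^ 2)"
      by (simp add: power_divide power_mult_distrib)
    finally show ?thesis .
  qed
  have "(\<Sum>s\<in>R - {r}. norm (exp_sum K (\<theta> r - \<theta> s)) ^ 2) \<le> (\<Sum>s\<in>R - {r}. 16 / \<delta> ^ 2 * (1 / of_int (k s) ^ 2))"
    by (intro sum_mono single)
  also have "\<dots> = 16 / \<delta> ^ 2 * (\<Sum>j\<in>k ` (R - {r}). 1 / of_int j ^ 2)"
    using \<open>inj_on k (R - {r})\<close> by (simp add: sum.reindex sum_distrib_left)
  also have "\<dots> \<le> 16 / \<delta> ^ 2 * 4"
    using assms(1) k_ne0 by (intro mult_left_mono sum_inverse_square_int_le) force+
  finally have rest: "(\<Sum>s\<in>R - {r}. norm (exp_sum K (\<theta> r - \<theta> s)) ^ 2) \<le> 64 / \<delta> ^ 2" by simp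
  have "norm (exp_sum K (\<theta> r - \<theta> r)) ^ 2 \<le> real K ^ 2"
    using norm_exp_sum_le by (intro power_mono) auto
  with rest show ?thesis unfolding sum.remove[OF assms(1,3)] by linarith
qed

text \<open>Averaging over shifts replaces the sharp cutoff in \<open>\<nu>\<close> by a nonnegative
  kernel, the squared modulus of an exponential sum, whose row sums were bounded above. Once
  \<open>X\<close> is at least \<open>1 / \<delta>\<close> the factor is of order
  \<open>X\<close>.\<close>

theorem large_sieve:
  fixes \<theta> :: "'a \<Rightarrow> real" and c :: "'a \<Rightarrow> complex"
  assumes "finite R" "\<delta> > 0" "X > 0"
    and spaced: "\<And>r s k. r \<in> R \<Longrightarrow> s \<in> R \<Longrightarrow> r \<noteq> s \<Longrightarrow> \<delta> \<le> \<bar>\<theta> r - \<theta> s - of_int k\<bar>"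
  shows "(\<Sum>\<nu>=1..X. norm (\<Sum>r\<in>R. c r * cis (2 * pi * real \<nu> * \<theta> r)) ^ 2)
    \<le> (4 * real X + 64 / (real X * \<delta> ^ 2)) * (\<Sum>r\<in>R. norm (c r) ^ 2)"
proof -
  define F where "F u = (\<Sum>r\<in>R. c r * cis (2 * pi * u * \<theta> r))" for u :: real
  define K where "K = 2 * X"
  define B where "B = real K ^ 2 + 64 / \<delta> ^ 2"
  define A where "A r s = norm (exp_sum K (\<theta> r - \<theta> s)) ^ 2" for r s
  have A_commute: "A s r = A r s" for r s
  proof -
    have "exp_sum K (\<theta> s - \<theta> r) = cnj (exp_sum K (\<theta> r - \<theta> s))"
      using exp_sum_uminus[of K "\<theta> r - \<theta> s"] by simp
    then show ?thesis by (simp add: A_def)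
  qed
  \<comment> \<open>Each \<open>\<nu>\<close> is written as a difference
    \<open>(j + \<nu>) - j\<close> in \<open>X\<close> ways. Both entries lie below
    \<open>K = 2 * X\<close>, so by positivity the sum may be enlarged to the full square of
    indices.\<close>
  have "real X * (\<Sum>\<nu>=1..X. norm (F \<nu>) ^ 2) = (\<Sum>j<X. \<Sum>\<nu>=1..X. norm (F (real (j + \<nu>) - real j)) ^ 2)"
    by simp
  also have "\<dots> = (\<Sum>(j, \<nu>)\<in>{..<X} \<times> {1..X}. norm (F (real (j + \<nu>) - real j)) ^ 2)"
    by (rule sum.cartesian_product)
  also have "\<dots> = (\<Sum>(i, j)\<in>(\<lambda>(j, \<nu>). (j + \<nu>, j)) ` ({..<X} \<times> {1..X}). norm (F (real i - real j)) ^ 2)"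
    by (subst sum.reindex) (auto simp: inj_on_def intro!: sum.cong)
  also have "\<dots> \<le> (\<Sum>(i, j)\<in>{..<K} \<times> {..<K}. norm (F (real i - real j)) ^ 2)"
    by (intro sum_mono2) (auto simp: K_def)
  also have "\<dots> = (\<Sum>i<K. \<Sum>j<K. norm (F (real i - real j)) ^ 2)"
    by (simp add: sum.cartesian_product)
  \<comment> \<open>Moving to complex numbers allows each square to be opened as \<open>F\<close>
    times its conjugate.\<close>
  also have "\<dots> \<le> norm (\<Sum>i<K. \<Sum>j<K. of_real (norm (F (real i - real j)) ^ 2) :: complex)"
    unfolding of_real_sum[symmetric] norm_of_real by simp
  also have "(\<Sum>i<K. \<Sum>j<K. of_real (norm (F (real i - real j)) ^ 2) :: complex) =
      (\<Sum>r\<in>R. \<Sum>s\<in>R. c r * cnj (c s) * of_real (A r s))"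
  proof -
    have "(\<Sum>i<K. \<Sum>j<K. of_real (norm (F (real i - real j)) ^ 2) :: complex) =
      (\<Sum>i<K. \<Sum>j<K. \<Sum>r\<in>R. \<Sum>s\<in>R. c r * cnj (c s) * cis (2 * pi * (real i - real j) * (\<theta> r - \<theta> s)))"
    proof (intro sum.cong refl)
      fix i j
      have "complex_of_real (norm (F (real i - real j)) ^ 2) = F (real i - real j) * cnj (F (real i - real j))"
        by (rule complex_norm_square)
      also have "\<dots> = (\<Sum>r\<in>R. \<Sum>s\<in>R. c r * cnj (c s) * cis (2 * pi * (real i - real j) * (\<theta> r - \<theta> s)))"
        unfolding F_def cnj_sum sum_product
      proof (intro sum.cong refl)
        fix r s
        have "cis (2 * pi * (real i - real j) * (\<theta> r - \<theta> s)) =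
          cis (2 * pi * (real i - real j) * \<theta> r) * cnj (cis (2 * pi * (real i - real j) * \<theta> s))"
          by (simp add: cis_cnj cis_mult algebra_simps)
        then show "c r * cis (2 * pi * (real i - real j) * \<theta> r) * cnj (c s * cis (2 * pi * (real i - real j) * \<theta> s)) =
          c r * cnj (c s) * cis (2 * pi * (real i - real j) * (\<theta> r - \<theta> s))"
          by simp
      qed
      finally show "complex_of_real (norm (F (real i - real j)) ^ 2) = \<dots>" .
    qed
    also have "\<dots> = (\<Sum>i<K. \<Sum>r\<in>R. \<Sum>j<K. \<Sum>s\<in>R. c r * cnj (c s) * cis (2 * pi * (real i - real j) * (\<theta> r - \<theta> s)))"
      by (intro sum.cong refl sum.swap)
    also have "\<dots> = (\<Sum>r\<in>R. \<Sum>i<K. \<Sum>j<K. \<Sum>s\<in>R. c r * cnj (c s) * cis (2 * pi * (real i - real j) * (\<theta> r - \<theta> s)))"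
      by (rule sum.swap)
    also have "\<dots> = (\<Sum>r\<in>R. \<Sum>i<K. \<Sum>s\<in>R. \<Sum>j<K. c r * cnj (c s) * cis (2 * pi * (real i - real j) * (\<theta> r - \<theta> s)))"
      by (intro sum.cong refl sum.swap)
    also have "\<dots> = (\<Sum>r\<in>R. \<Sum>s\<in>R. \<Sum>i<K. \<Sum>j<K. c r * cnj (c s) * cis (2 * pi * (real i - real j) * (\<theta> r - \<theta> s)))"
      by (intro sum.cong refl sum.swap)
    also have "\<dots> = (\<Sum>r\<in>R. \<Sum>s\<in>R. c r * cnj (c s) * of_real (A r s))"
      unfolding A_def complex_norm_square exp_sum_mult_cnj by (simp add: sum_distrib_left)
    finally show ?thesis .
  qed
  also have "norm (\<Sum>r\<in>R. \<Sum>s\<in>R. c r * cnj (c s) * of_real (A r s))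
      \<le> (\<Sum>r\<in>R. \<Sum>s\<in>R. norm (c r * cnj (c s) * of_real (A r s)))"
    by (intro order.trans[OF norm_sum] sum_mono order.refl)
  \<comment> \<open>Schur's test: split the product \<open>norm (c r) * norm (c s)\<close> into
    squares, then use the symmetry of \<open>A\<close> and its row sums.\<close>
  also have "\<dots> \<le> (\<Sum>r\<in>R. \<Sum>s\<in>R. (norm (c r) ^ 2 * A r s) / 2 + (norm (c s) ^ 2 * A r s) / 2)"
  proof (intro sum_mono)
    fix r s
    have "norm (c r * cnj (c s) * of_real (A r s)) = norm (c r) * norm (c s) * A r s"
      by (simp add: norm_mult norm_power A_def)
    also have "\<dots> \<le> ((norm (c r) ^ 2 + norm (c s) ^ 2) / 2) * A r s"
      using sum_squares_bound[of "norm (c r)" "norm (c s)"] by (intro mult_right_mono) (auto simp: A_def)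
    finally show "norm (c r * cnj (c s) * of_real (A r s)) \<le> (norm (c r) ^ 2 * A r s) / 2 + (norm (c s) ^ 2 * A r s) / 2"
      by (simp add: field_simps)
  qed
  also have "\<dots> = (\<Sum>r\<in>R. \<Sum>s\<in>R. (norm (c r) ^ 2 * A r s) / 2) + (\<Sum>r\<in>R. \<Sum>s\<in>R. (norm (c s) ^ 2 * A r s) / 2)"
    by (simp add: sum.distrib)
  also have "(\<Sum>r\<in>R. \<Sum>s\<in>R. (norm (c s) ^ 2 * A r s) / 2) = (\<Sum>r\<in>R. \<Sum>s\<in>R. (norm (c r) ^ 2 * A r s) / 2)"
    by (subst sum.swap) (simp only: A_commute)
  also have "(\<Sum>r\<in>R. \<Sum>s\<in>R. (norm (c r) ^ 2 * A r s) / 2) + (\<Sum>r\<in>R. \<Sum>s\<in>R. (norm (c r) ^ 2 * A r s) / 2)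
      = (\<Sum>r\<in>R. norm (c r) ^ 2 * (\<Sum>s\<in>R. A r s))"
    unfolding sum.distrib[symmetric] sum_distrib_left by (simp add: mult.commute)
  also have "\<dots> \<le> (\<Sum>r\<in>R. norm (c r) ^ 2 * B)"
  proof (intro sum_mono mult_left_mono)
    fix r assume "r \<in> R"
    then show "(\<Sum>s\<in>R. A r s) \<le> B"
      unfolding A_def B_def using assms by (intro sum_norm_exp_sum_spaced_le) auto
  qed auto
  also have "\<dots> = B * (\<Sum>r\<in>R. norm (c r) ^ 2)" by (simp add: sum_distrib_left mult.commute)
  finally have "real X * (\<Sum>\<nu>=1..X. norm (F \<nu>) ^ 2) \<le> B * (\<Sum>r\<in>R. norm (c r) ^ 2)" .
  then have "(\<Sum>\<nu>=1..X. norm (F \<nu>) ^ 2) \<le> B / real X * (\<Sum>r\<in>R. norm (c r) ^ 2)"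
    using \<open>X > 0\<close> by (simp add: field_simps)
  also have "B / real X = 4 * real X + 64 / (real X * \<delta> ^ 2)"
    using \<open>X > 0\<close> \<open>\<delta> > 0\<close> by (simp add: B_def K_def field_simps power2_eq_square)
  finally show ?thesis by (simp add: F_def)
qed

section \<open>A large sieve for the Jacobi symbol\<close>

definition unit_exp :: "real \<Rightarrow> complex" where
  "unit_exp x = cis (2 * pi * x)"

lemma unit_exp_add: "unit_exp (x + y) = unit_exp x * unit_exp y"
  by (simp add: unit_exp_def cis_mult algebra_simps)

lemma unit_exp_int [simp]: "unit_exp (of_int k) = 1"
  by (simp add: unit_exp_def cis_multiple_2pi)

lemma cnj_unit_exp: "cnj (unit_exp x) = unit_exp (- x)"
  by (simp add: unit_exp_def cis_cnj)

lemma unit_exp_power: "unit_exp x ^ n = unit_exp (real n * x)"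
  by (simp add: unit_exp_def DeMoivre mult_ac)

lemma unit_exp_eq_1_iff: "unit_exp x = 1 \<longleftrightarrow> x \<in> \<int>"
proof
  assume "unit_exp x = 1"
  then have "cos (2 * pi * x) = 1" by (simp add: unit_exp_def complex_eq_iff)
  then obtain n where "2 * pi * x = of_int n * 2 * pi" using cos_one_2pi_int by blast
  then have "x = of_int n" by simp
  then show "x \<in> \<int>" by simp
next
  assume "x \<in> \<int>"
  then show "unit_exp x = 1" by (auto elim: Ints_cases)
qed

lemma sum_unit_exp:
  assumes "m > 0"
  shows "(\<Sum>a<m. unit_exp (real a * of_int k / real m)) = (if int m dvd k then of_nat m else 0)"
proof -
  define z where "z = unit_exp (of_int k / real m)"
  have eq: "(\<Sum>a<m. unit_exp (real a * of_int k / real m)) = (\<Sum>a<m. z ^ a)"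
    by (simp add: z_def unit_exp_power)
  show ?thesis
  proof (cases "int m dvd k")
    case True
    then obtain l where "k = int m * l" by auto
    then have "z = 1" using assms by (simp add: z_def)
    then show ?thesis using eq True by simp
  next
    case False
    have "z \<noteq> 1"
    proof
      assume "z = 1"
      then obtain l where "of_int k / real m = of_int l" unfolding z_def unit_exp_eq_1_iff by (auto elim: Ints_cases)
      then have "real_of_int k = of_int (int m * l)" using assms by (simp add: field_simps)
      then have "k = int m * l" by (simp only: of_int_eq_iff)
      with False show False by simp
    qed
    moreover have "z ^ m = 1" using assms by (simp add: z_def unit_exp_power)
    ultimately show ?thesis using eq False geometric_sum[of z m] by simp
  qed
qed

text \<open>Normalised Gauss sums: the factor \<open>1 / m\<close> sits in the coefficients, so the
  inversion formula carries none.\<close>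

definition jacobi_fourier :: "nat \<Rightarrow> nat \<Rightarrow> complex" where
  "jacobi_fourier m a =
     (\<Sum>t\<in>{0..<int m}. of_int (jacobi t m) * unit_exp (- (real a * of_int t / real m))) / of_nat m"

lemma jacobi_fourier_inversion:
  assumes "m > 0"
  shows "(\<Sum>a<m. jacobi_fourier m a * unit_exp (real a * of_int k / real m)) = of_int (jacobi k m)"
proof -
  have "(\<Sum>a<m. jacobi_fourier m a * unit_exp (real a * of_int k / real m)) =
    (\<Sum>a<m. \<Sum>t\<in>{0..<int m}. of_int (jacobi t m) / of_nat m * unit_exp (real a * of_int (k - t) / real m))"
    unfolding jacobi_fourier_def sum_divide_distrib sum_distrib_right
  proof (intro sum.cong refl)
    fix a t
    have "real a * of_int (k - t) / real m = - (real a * of_int t / real m) + real a * of_int k / real m"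
      by (simp add: algebra_simps diff_divide_distrib)
    then have "unit_exp (real a * of_int (k - t) / real m) =
      unit_exp (- (real a * of_int t / real m)) * unit_exp (real a * of_int k / real m)"
      by (simp only: unit_exp_add)
    then show "of_int (jacobi t m) * unit_exp (- (real a * of_int t / real m)) / of_nat m *
         unit_exp (real a * of_int k / real m) =
         of_int (jacobi t m) / of_nat m * unit_exp (real a * of_int (k - t) / real m)" by simp
  qed
  also have "\<dots> = (\<Sum>t\<in>{0..<int m}. of_int (jacobi t m) / of_nat m * (\<Sum>a<m. unit_exp (real a * of_int (k - t) / real m)))"
    unfolding sum_distrib_left by (rule sum.swap)
  also have "\<dots> = (\<Sum>t\<in>{0..<int m}. if t = k mod int m then of_int (jacobi t m) else 0)"
  proof (intro sum.cong refl)
    fix t assume t: "t \<in> {0..<int m}"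
    have "int m dvd k - t \<longleftrightarrow> t = k mod int m"
      using t by (auto simp: mod_eq_dvd_iff[symmetric])
    then show "of_int (jacobi t m) / of_nat m * (\<Sum>a<m. unit_exp (real a * of_int (k - t) / real m)) =
      (if t = k mod int m then of_int (jacobi t m) else 0)"
      using assms by (simp only: sum_unit_exp[OF assms]) auto
  qed
  also have "\<dots> = of_int (jacobi (k mod int m) m)" using assms by simp
  also have "jacobi (k mod int m) m = jacobi k m" by (rule jacobi_cong) simp
  finally show ?thesis .
qed

text \<open>Parseval: opening one factor of each square and applying inversion turns the sum into
  the mean of the squared symbol over a period.\<close>

lemma sum_norm_jacobi_fourier_le:
  assumes "m > 0"
  shows "(\<Sum>a<m. norm (jacobi_fourier m a) ^ 2) \<le> 1"
proof -
  have "complex_of_real (\<Sum>a<m. norm (jacobi_fourier m a) ^ 2) =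
    (\<Sum>a<m. jacobi_fourier m a * (\<Sum>t\<in>{0..<int m}. of_int (jacobi t m) * unit_exp (real a * of_int t / real m)) / of_nat m)"
    unfolding of_real_sum complex_norm_square
    by (intro sum.cong refl) (simp add: jacobi_fourier_def cnj_sum cnj_unit_exp)
  also have "\<dots> = (\<Sum>a<m. \<Sum>t\<in>{0..<int m}. of_int (jacobi t m) / of_nat m * (jacobi_fourier m a * unit_exp (real a * of_int t / real m)))"
    unfolding sum_distrib_left sum_divide_distrib by (intro sum.cong refl) simp
  also have "\<dots> = (\<Sum>t\<in>{0..<int m}. of_int (jacobi t m) / of_nat m * (\<Sum>a<m. jacobi_fourier m a * unit_exp (real a * of_int t / real m)))"
    unfolding sum_distrib_left by (rule sum.swap)
  also have "\<dots> = (\<Sum>t\<in>{0..<int m}. of_int (jacobi t m) / of_nat m * of_int (jacobi t m))"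
    by (simp only: jacobi_fourier_inversion[OF assms])
  also have "\<dots> = complex_of_real (\<Sum>t\<in>{0..<int m}. real_of_int (jacobi t m) ^ 2 / real m)"
    by (simp add: power2_eq_square)
  finally have "(\<Sum>a<m. norm (jacobi_fourier m a) ^ 2) = (\<Sum>t\<in>{0..<int m}. real_of_int (jacobi t m) ^ 2 / real m)"
    by (simp only: of_real_eq_iff)
  also have "\<dots> \<le> (\<Sum>t\<in>{0..<int m}. 1 / real m)"
  proof (intro sum_mono divide_right_mono)
    fix t
    have "\<bar>real_of_int (jacobi t m)\<bar> \<le> 1" using abs_jacobi_le_1[of t m] by linarith
    then show "real_of_int (jacobi t m) ^ 2 \<le> 1" by (simp add: abs_square_le_1)
  qed auto
  also have "\<dots> = 1" using assms by simp
  finally show ?thesis .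
qed

text \<open>For square-free \<open>m\<close> the character \<open>jacobi _ m\<close> is primitive: if a prime \<open>p\<close> divides both \<open>a\<close>
  and \<open>m\<close>, multiplying \<open>t\<close> by a \<open>u \<equiv> 1\<close> modulo \<open>m div p\<close> with \<open>jacobi u m = -1\<close> keeps the
  exponential but flips the sign of the symbol.\<close>

lemma jacobi_fourier_eq_0:
  assumes "odd m" "squarefree m" "\<not> coprime a m"
  shows "jacobi_fourier m a = 0"
proof -
  have "m > 0" using assms(1) by (cases m) auto
  have "gcd a m \<noteq> 1" using assms(3) coprime_iff_gcd_eq_1[of a m] by blast
  then obtain p where "prime p" "p dvd gcd a m" using prime_factor_nat by blast
  then have p: "prime p" "p dvd a" "p dvd m" by auto
  obtain u where u: "jacobi u m = -1" "[u = 1] (mod int (m div p))" "coprime u (int m)"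
    using ex_jacobi_twist[OF assms(1,2) p(1,3)] .
  obtain a' where a': "a = p * a'" using p(2) by auto
  define m' where "m' = m div p"
  have m': "m = p * m'" using p by (simp add: m'_def)
  obtain w where w: "u - 1 = int m' * w" using u(2) by (auto simp: m'_def cong_iff_dvd_diff)
  have pos: "p > 0" "m' > 0" using \<open>m > 0\<close> m' by auto
  define G where "G t = of_int (jacobi t m) * unit_exp (- (real a * of_int t / real m))" for t
  have exp_shift: "unit_exp (- (real a * of_int (t + k) / real m)) = unit_exp (- (real a * of_int t / real m))"
    if dv: "int m dvd int a * k" for t k
  proof -
    obtain l where "int a * k = int m * l" using dv by (rule dvdE)
    then have "real a * of_int k = real m * of_int l" by (metis of_int_mult of_int_of_nat_eq)
    then have "- (real a * of_int (t + k) / real m) = - (real a * of_int t / real m) + of_int (- l)"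
      using \<open>m > 0\<close> by (simp add: field_simps)
    then show ?thesis by (simp only: unit_exp_add unit_exp_int mult_1_right)
  qed
  have G_mod: "G (t mod int m) = G t" for t
  proof -
    have "t = t mod int m + int m * (t div int m)" by simp
    then have "unit_exp (- (real a * of_int t / real m)) = unit_exp (- (real a * of_int (t mod int m) / real m))"
      using exp_shift[of "int m * (t div int m)" "t mod int m"] by simp
    moreover have "jacobi (t mod int m) m = jacobi t m" by (rule jacobi_cong) simp
    ultimately show ?thesis by (simp add: G_def)
  qed
  have G_mult: "G (u * t) = - G t" for t
  proof -
    have "int a * ((u - 1) * t) = int m * (int a' * w * t)" unfolding w a' m' by simp
    then have "int m dvd int a * ((u - 1) * t)" by (rule dvdI)
    from exp_shift[OF this, of t]
    have "unit_exp (- (real a * of_int (u * t) / real m)) = unit_exp (- (real a * of_int t / real m))"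
      by (simp add: algebra_simps)
    then show ?thesis using jacobi_mult_left[OF assms(1), of u t] u(1) by (simp add: G_def)
  qed
  have inj: "inj_on (\<lambda>t. u * t mod int m) {0..<int m}"
  proof (rule inj_onI)
    fix s t assume st: "s \<in> {0..<int m}" "t \<in> {0..<int m}" "u * s mod int m = u * t mod int m"
    then have "[u * s = u * t] (mod int m)" by (simp add: cong_def)
    then have "[s = t] (mod int m)" using cong_mult_lcancel[OF u(3)] by blast
    then show "s = t" using st by (simp add: cong_def)
  qed
  have "(\<lambda>t. u * t mod int m) ` {0..<int m} = {0..<int m}"
    using inj \<open>m > 0\<close> by (intro endo_inj_surj) auto
  then have "sum G {0..<int m} = (\<Sum>t\<in>{0..<int m}. G (u * t mod int m))"
    using sum.reindex[OF inj, of G] by simp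
  also have "\<dots> = - sum G {0..<int m}" by (simp add: G_mod G_mult sum_negf)
  finally have "sum G {0..<int m} = 0" by simp
  then show ?thesis by (simp add: jacobi_fourier_def G_def)
qed

text \<open>Clearing denominators leaves an integer \<open>N\<close>. If it were 0, coprimality
  would make \<open>m\<close> and \<open>n\<close> divide each other, and then \<open>a\<close> and
  \<open>b\<close> would be congruent modulo \<open>m\<close>, hence equal.\<close>

lemma reduced_fractions_spaced:
  assumes "m > 0" "n > 0" "a < m" "b < n" "coprime a m" "coprime b n" "(m, a) \<noteq> (n, b)"
  shows "1 / (real m * real n) \<le> \<bar>real a / real m - real b / real n - of_int k\<bar>"
proof -
  define N where "N = int a * int n - int b * int m - k * int m * int n"
  have eq: "real a / real m - real b / real n - of_int k = of_int N / (real m * real n)"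
    using assms(1,2) by (simp add: N_def field_simps)
  have "N \<noteq> 0"
  proof
    assume "N = 0"
    then have 1: "int a * int n = int m * (int b + k * int n)" and 2: "int b * int m = int n * (int a - k * int m)"
      by (simp_all add: N_def algebra_simps)
    have "int m dvd int a * int n" unfolding 1 by simp
    then have "m dvd n" using assms(5) by (simp add: coprime_commute coprime_dvd_mult_right_iff flip: of_nat_mult)
    have "int n dvd int b * int m" unfolding 2 by simp
    then have "n dvd m" using assms(6) by (simp add: coprime_commute coprime_dvd_mult_right_iff flip: of_nat_mult)
    have "m = n" using \<open>m dvd n\<close> \<open>n dvd m\<close> by (rule dvd_antisym)
    with 1 have "int a = int b + k * int m" using assms(1) by simp
    then have "int a mod int m = int b mod int m" by simp
    then have "a = b" using assms(3,4) \<open>m = n\<close> by simp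
    with \<open>m = n\<close> assms(7) show False by simp
  qed
  then have "1 \<le> \<bar>real_of_int N\<bar>" by linarith
  then show ?thesis unfolding eq abs_divide using assms(1,2) by (simp add: divide_right_mono)
qed

text \<open>The frequencies are the reduced fractions with denominators in \<open>A\<close>, which
  are \<open>1 / L\<^sup>2\<close> apart modulo 1. By Parseval each modulus contributes coefficients
  of total square mass at most 1, whence the factor \<open>card A\<close>.\<close>

theorem jacobi_large_sieve:
  assumes "finite A" "X > 0" "L > 0"
    and A: "\<And>m. m \<in> A \<Longrightarrow> odd m \<and> squarefree m \<and> m \<le> L"
  shows "(\<Sum>\<nu>=1..X. (\<Sum>m\<in>A. real_of_int (jacobi (int \<nu>) m)) ^ 2)
    \<le> (4 * real X + 64 * real L ^ 4 / real X) * card A"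
proof -
  have pos: "m > 0" if "m \<in> A" for m using A[OF that] by (cases m) auto
  define S where "S m = {a\<in>{..<m}. coprime a m}" for m :: nat
  define R where "R = Sigma A S"
  define c where "c = (\<lambda>(m, a). jacobi_fourier m a)"
  define \<theta> where "\<theta> = (\<lambda>(m, a). real a / real m)"
  define \<delta> where "\<delta> = 1 / real L ^ 2"
  have "finite R" unfolding R_def S_def using assms(1) by auto
  have "\<delta> > 0" using assms(3) by (simp add: \<delta>_def)
  have spaced: "\<delta> \<le> \<bar>\<theta> r - \<theta> s - of_int k\<bar>" if rs: "r \<in> R" "s \<in> R" "r \<noteq> s" for r s k
  proof -
    obtain m a n b where r: "r = (m, a)" and s: "s = (n, b)" by (cases r, cases s) auto
    have m: "m \<in> A" "a < m" "coprime a m" and n: "n \<in> A" "b < n" "coprime b n"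
      using rs by (auto simp: r s R_def S_def)
    have "real m * real n \<le> real L ^ 2"
      unfolding power2_eq_square using A[OF m(1)] A[OF n(1)] by (intro mult_mono) auto
    then have "\<delta> \<le> 1 / (real m * real n)"
      unfolding \<delta>_def using pos m n assms(3) by (intro divide_left_mono) auto
    also have "\<dots> \<le> \<bar>real a / real m - real b / real n - of_int k\<bar>"
      using m n rs pos by (intro reduced_fractions_spaced) (auto simp: r s)
    finally show ?thesis by (simp add: r s \<theta>_def)
  qed
  have expand: "(\<Sum>m\<in>A. of_int (jacobi (int \<nu>) m)) = (\<Sum>r\<in>R. c r * cis (2 * pi * real \<nu> * \<theta> r))" for \<nu>
  proof -
    have "(\<Sum>m\<in>A. of_int (jacobi (int \<nu>) m)) = (\<Sum>m\<in>A. \<Sum>a\<in>S m. jacobi_fourier m a * unit_exp (real a * of_int (int \<nu>) / real m))"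
    \<comment> \<open>Primitivity removes the frequencies that are not in lowest terms. Otherwise
      one fraction could arise from several moduli, which would destroy the spacing.\<close>
    proof (intro sum.cong refl)
      fix m assume m: "m \<in> A"
      have "(\<Sum>a\<in>S m. jacobi_fourier m a * unit_exp (real a * of_int (int \<nu>) / real m)) =
        (\<Sum>a<m. jacobi_fourier m a * unit_exp (real a * of_int (int \<nu>) / real m))"
        using A[OF m] by (intro sum.mono_neutral_left) (auto simp: S_def jacobi_fourier_eq_0)
      then show "of_int (jacobi (int \<nu>) m) = (\<Sum>a\<in>S m. jacobi_fourier m a * unit_exp (real a * of_int (int \<nu>) / real m))"
        using jacobi_fourier_inversion[OF pos[OF m], of "int \<nu>"] by simp
    qed
    also have "\<dots> = (\<Sum>(m, a)\<in>R. jacobi_fourier m a * unit_exp (real a * of_int (int \<nu>) / real m))"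
      unfolding R_def using assms(1) by (intro sum.Sigma) (auto simp: S_def)
    also have "\<dots> = (\<Sum>r\<in>R. c r * cis (2 * pi * real \<nu> * \<theta> r))"
      by (intro sum.cong refl) (auto simp: c_def \<theta>_def unit_exp_def mult_ac)
    finally show ?thesis .
  qed
  have "(\<Sum>\<nu>=1..X. (\<Sum>m\<in>A. real_of_int (jacobi (int \<nu>) m)) ^ 2) =
    (\<Sum>\<nu>=1..X. norm (\<Sum>r\<in>R. c r * cis (2 * pi * real \<nu> * \<theta> r)) ^ 2)"
  proof (intro sum.cong refl)
    fix \<nu>
    have "norm (\<Sum>r\<in>R. c r * cis (2 * pi * real \<nu> * \<theta> r)) =
      norm (complex_of_real (\<Sum>m\<in>A. real_of_int (jacobi (int \<nu>) m)))"
      unfolding expand[symmetric] by simp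
    then show "(\<Sum>m\<in>A. real_of_int (jacobi (int \<nu>) m)) ^ 2 = norm (\<Sum>r\<in>R. c r * cis (2 * pi * real \<nu> * \<theta> r)) ^ 2"
      by (simp only: norm_of_real power2_abs)
  qed
  also have "\<dots> \<le> (4 * real X + 64 / (real X * \<delta> ^ 2)) * (\<Sum>r\<in>R. norm (c r) ^ 2)"
    using \<open>finite R\<close> \<open>\<delta> > 0\<close> assms(2) spaced by (rule large_sieve)
  also have "64 / (real X * \<delta> ^ 2) = 64 * real L ^ 4 / real X"
    using assms by (simp add: \<delta>_def power_divide flip: power_mult)
  also have "(\<Sum>r\<in>R. norm (c r) ^ 2) = (\<Sum>m\<in>A. \<Sum>a\<in>S m. norm (jacobi_fourier m a) ^ 2)"
    unfolding R_def c_def using assms(1) by (subst sum.Sigma) (auto simp: S_def case_prod_unfold)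
  also have "(4 * real X + 64 * real L ^ 4 / real X) * \<dots> \<le> (4 * real X + 64 * real L ^ 4 / real X) * (\<Sum>m\<in>A. 1)"
  proof (intro mult_left_mono sum_mono)
    fix m assume m: "m \<in> A"
    have "(\<Sum>a\<in>S m. norm (jacobi_fourier m a) ^ 2) \<le> (\<Sum>a<m. norm (jacobi_fourier m a) ^ 2)"
      by (intro sum_mono2) (auto simp: S_def)
    also have "\<dots> \<le> 1" using pos[OF m] by (rule sum_norm_jacobi_fourier_le)
    finally show "(\<Sum>a\<in>S m. norm (jacobi_fourier m a) ^ 2) \<le> 1" .
  qed auto
  finally show ?thesis by simp
qed

section \<open>Maximal inequality and multiplicative energy\<close>

lemma sum_pairs: "(\<Sum>t\<in>{2 * a..<2 * b}. f t) = (\<Sum>s\<in>{a..<b}. f (2 * s) + f (2 * s + 1))"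
  for f :: "nat \<Rightarrow> real"
proof (induction b)
  case (Suc b)
  show ?case
  proof (cases "a \<le> b")
    case True
    then have "{2 * a..<2 * Suc b} = insert (2 * b + 1) (insert (2 * b) {2 * a..<2 * b})" by auto
    then show ?thesis using True Suc by (simp add: algebra_simps)
  next
    case False
    then have "{2 * a..<2 * Suc b} = {}" "{a..<Suc b} = {}" by auto
    then show ?thesis by simp
  qed
qed simp

text \<open>The weights are chosen so that adding one dyadic level raises the factor only from
  \<open>n\<close> to \<open>n + 1\<close>; the defect is the square
  \<open>(a - n * b)\<^sup>2\<close>.\<close>

lemma square_add_le:
  fixes a b n :: real
  assumes "n > 0" "a ^ 2 \<le> n * U" "b ^ 2 \<le> V"
  shows "(a + b) ^ 2 \<le> (n + 1) * (U + V)"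
proof -
  have "n * (a + b) ^ 2 = (n + 1) * a ^ 2 + n * (n + 1) * b ^ 2 - (a - n * b) ^ 2"
    by (simp add: power2_eq_square algebra_simps)
  also have "\<dots> \<le> (n + 1) * a ^ 2 + n * (n + 1) * b ^ 2" by simp
  also have "\<dots> \<le> (n + 1) * (n * U) + n * (n + 1) * V"
    using assms by (intro add_mono mult_left_mono) auto
  also have "\<dots> = n * ((n + 1) * (U + V))" by (simp add: algebra_simps)
  finally show ?thesis using assms(1) by simp
qed

text \<open>The inequality behind the Rademacher--Menshov theorem.\<close>

lemma prefix_sum_square_le:
  fixes f :: "nat \<Rightarrow> real"
  assumes "y \<le> 2 ^ i"
  shows "(\<Sum>t<y. f t) ^ 2 \<le> real (Suc i) * (\<Sum>j\<le>i. \<Sum>k<2 ^ (i - j). (\<Sum>t\<in>{k * 2 ^ j..<Suc k * 2 ^ j}. f t) ^ 2)"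
  using assms
proof (induction i arbitrary: f y)
  case 0
  then have "y = 0 \<or> y = 1" by auto
  then show ?case by (auto simp: lessThan_Suc)
next
  case (Suc i)
  \<comment> \<open>Merging neighbours halves the length. The induction hypothesis for
    \<open>g\<close> accounts for the levels \<open>j \<ge> 1\<close> of \<open>f\<close>, while the
    last term \<open>b\<close> of a prefix of odd length is absorbed by level 0, which is
    \<open>B\<close>.\<close>
  define g where "g s = f (2 * s) + f (2 * s + 1)" for s
  define W where "W = (\<Sum>j\<le>i. \<Sum>k<2 ^ (i - j). (\<Sum>t\<in>{k * 2 ^ j..<Suc k * 2 ^ j}. g t) ^ 2)"
  define B where "B = (\<Sum>k<2 ^ Suc i. (f k) ^ 2)"
  define b where "b = (if odd y then f (y - 1) else 0)"
  have "y div 2 \<le> 2 ^ i" using Suc.prems by auto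
  then have A: "(\<Sum>s<y div 2. g s) ^ 2 \<le> real (Suc i) * W" unfolding W_def by (rule Suc.IH)
  have b: "b ^ 2 \<le> B"
  proof (cases "odd y")
    case True
    then have "y - 1 < 2 ^ Suc i" using Suc.prems by (cases y) auto
    then have "(f (y - 1)) ^ 2 \<le> B" unfolding B_def by (intro member_le_sum) auto
    then show ?thesis using True by (simp add: b_def)
  next
    case False
    then show ?thesis by (simp add: b_def B_def sum_nonneg)
  qed
  have even_part: "(\<Sum>t<2 * z. f t) = (\<Sum>s<z. g s)" for z
    using sum_pairs[of f 0 z] by (simp add: g_def atLeast0LessThan)
  have "(\<Sum>t<y. f t) = (\<Sum>s<y div 2. g s) + b"
  proof (cases "odd y")
    case True
    then obtain z where "y = Suc (2 * z)" by (metis oddE Suc_eq_plus1)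
    then show ?thesis by (simp add: b_def even_part)
  next
    case False
    then obtain z where "y = 2 * z" by auto
    then show ?thesis by (simp add: b_def even_part)
  qed
  then have "(\<Sum>t<y. f t) ^ 2 \<le> (real (Suc i) + 1) * (W + B)"
    using square_add_le[OF _ A b] by simp
  also have "W + B = (\<Sum>j\<le>Suc i. \<Sum>k<2 ^ (Suc i - j). (\<Sum>t\<in>{k * 2 ^ j..<Suc k * 2 ^ j}. f t) ^ 2)"
  proof -
    have "(\<Sum>t\<in>{k * 2 ^ j..<Suc k * 2 ^ j}. g t) = (\<Sum>t\<in>{k * 2 ^ Suc j..<Suc k * 2 ^ Suc j}. f t)" for k j
      using sum_pairs[of f "k * 2 ^ j" "Suc k * 2 ^ j"] by (simp add: g_def mult_ac)
    then have "W = (\<Sum>j\<le>i. \<Sum>k<2 ^ (Suc i - Suc j). (\<Sum>t\<in>{k * 2 ^ Suc j..<Suc k * 2 ^ Suc j}. f t) ^ 2)"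
      unfolding W_def by (simp only: diff_Suc_Suc)
    moreover have "B = (\<Sum>k<2 ^ (Suc i - 0). (\<Sum>t\<in>{k * 2 ^ 0..<Suc k * 2 ^ 0}. f t) ^ 2)"
      by (simp add: B_def)
    ultimately show ?thesis by (subst sum.atMost_Suc_shift) simp
  qed
  finally show ?case by simp
qed

section \<open>Fibre counts and multiplicative energy\<close>

lemma sum_over_fibers:
  fixes h :: "'b \<Rightarrow> real"
  assumes "finite P" "finite V" "F ` P \<subseteq> V"
  shows "(\<Sum>p\<in>P. h (F p)) = (\<Sum>v\<in>V. real (card {p\<in>P. F p = v}) * h v)"
proof -
  have "(\<Sum>p\<in>P. h (F p)) = (\<Sum>v\<in>V. \<Sum>p\<in>{p\<in>P. F p = v}. h (F p))"
    using sum.group[OF assms, of "\<lambda>p. h (F p)"] by simp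
  also have "\<dots> = (\<Sum>v\<in>V. real (card {p\<in>P. F p = v}) * h v)"
    by (intro sum.cong refl) simp
  finally show ?thesis .
qed

text \<open>Cauchy-Schwarz over the values of \<open>F\<close>: the second moment of the fibre sizes
  counts the pairs on which \<open>F\<close> collides.\<close>

lemma sum_fibers_Cauchy_Schwarz:
  fixes h :: "'b \<Rightarrow> real"
  assumes "finite P" "finite V" "F ` P \<subseteq> V"
  shows "(\<Sum>p\<in>P. h (F p)) ^ 2 \<le> real (card {(p, q). p \<in> P \<and> q \<in> P \<and> F p = F q}) * (\<Sum>v\<in>V. h v ^ 2)"
proof -
  define r where "r v = real (card {p\<in>P. F p = v})" for v
  have "(\<Sum>v\<in>V. r v ^ 2) = (\<Sum>p\<in>P. r (F p))"
    unfolding sum_over_fibers[OF assms, of r] by (simp add: r_def power2_eq_square)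
  also have "\<dots> = real (card (SIGMA p:P. {q\<in>P. F q = F p}))"
    using assms(1) by (simp add: r_def card_SigmaI)
  also have "(SIGMA p:P. {q\<in>P. F q = F p}) = {(p, q). p \<in> P \<and> q \<in> P \<and> F p = F q}" by auto
  finally have r: "(\<Sum>v\<in>V. r v ^ 2) = real (card {(p, q). p \<in> P \<and> q \<in> P \<and> F p = F q})" .
  have "(\<Sum>p\<in>P. h (F p)) ^ 2 = (\<Sum>v\<in>V. r v * h v) ^ 2"
    unfolding sum_over_fibers[OF assms, of h] r_def ..
  also have "\<dots> \<le> (\<Sum>v\<in>V. r v ^ 2) * (\<Sum>v\<in>V. h v ^ 2)" by (rule Cauchy_Schwarz_ineq_sum)
  finally show ?thesis by (simp only: r)
qed

lemma sum_inverse_le_ln: "n > 0 \<Longrightarrow> (\<Sum>k=1..n. 1 / real k) \<le> 1 + ln n"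
proof (induction n rule: nat_induct_non_zero)
  case (Suc n)
  have "ln (real n / real (Suc n)) \<le> real n / real (Suc n) - 1" using Suc by (intro ln_le_minus_one) auto
  also have "\<dots> = - (1 / real (Suc n))" by (simp add: field_simps)
  finally have "1 / real (Suc n) \<le> ln (real (Suc n)) - ln (real n)"
    using Suc by (simp add: ln_div del: of_nat_Suc)
  then show ?case using Suc by simp
qed simp

text \<open>With \<open>g = gcd a c\<close>, every solution of \<open>a * b = c * d\<close> has the
  form \<open>a = g * x\<close>, \<open>c = g * y\<close>, \<open>b = h * y\<close>,
  \<open>d = h * x\<close>. For fixed \<open>g\<close> and \<open>h\<close> both \<open>x\<close>
  and \<open>y\<close> are at most \<open>N div max g h\<close>. Dropping the coprimality of
  \<open>x\<close> and \<open>y\<close> only overcounts.\<close>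

lemma card_multiplicative_energy_le:
  assumes "N > 0"
  defines "P \<equiv> {1..N} \<times> {1..N}"
  shows "real (card {(p, q). p \<in> P \<and> q \<in> P \<and> fst p * snd p = fst q * snd q}) \<le> 2 * real N ^ 2 * (1 + ln N)"
proof -
  let ?Q = "{(p, q). p \<in> P \<and> q \<in> P \<and> fst p * snd p = fst q * snd q}"
  define I where "I = (\<lambda>(g, h). {1..N div max g h} \<times> {1..N div max g h})"
  define \<Phi> where "\<Phi> = (\<lambda>((g, h), (x, y)). ((g * x, h * y), (g * y, h * x :: nat)))"
  have "?Q \<subseteq> \<Phi> ` (Sigma P I)"
  proof
    fix z assume "z \<in> ?Q"
    then obtain a b c d where z: "z = ((a, b), (c, d))" and
      range: "a \<in> {1..N}" "b \<in> {1..N}" "c \<in> {1..N}" "d \<in> {1..N}" and eq: "a * b = c * d"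
      by (auto simp: P_def)
    define g where "g = gcd a c"
    have "g > 0" using range by (simp add: g_def)
    obtain x y where x: "a = g * x" and y: "c = g * y" and cop: "coprime x y"
      using gcd_coprime_exists[of a c] range unfolding g_def by (metis gcd_eq_0_iff mult.commute not_one_le_zero atLeastAtMost_iff)
    have xy: "x * b = y * d" using eq \<open>g > 0\<close> by (simp add: x y)
    then have "y dvd x * b" by simp
    then have "y dvd b" using cop by (simp add: coprime_commute coprime_dvd_mult_right_iff)
    then obtain h where h: "b = h * y" by (metis dvdE mult.commute)
    have "y > 0" "x > 0" "h > 0" using range x y h by (auto intro: Nat.gr0I)
    have d: "d = h * x" using xy \<open>y > 0\<close> by (simp add: h mult.commute)
    have bounds: "g * x \<le> N" "h * y \<le> N" "g * y \<le> N" "h * x \<le> N" using range x y h d by auto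
    have "g \<le> g * x" "h \<le> h * x" using \<open>x > 0\<close> by auto
    then have "g \<le> N" "h \<le> N" using bounds by linarith+
    then have "(g, h) \<in> P" using \<open>g > 0\<close> \<open>h > 0\<close> by (simp add: P_def)
    moreover have "(x, y) \<in> I (g, h)"
      using bounds \<open>x > 0\<close> \<open>y > 0\<close> \<open>g > 0\<close> \<open>h > 0\<close>
      by (auto simp: I_def less_eq_div_iff_mult_less_eq max_def mult.commute)
    moreover have "z = \<Phi> ((g, h), (x, y))" by (simp add: \<Phi>_def z x y h d)
    ultimately show "z \<in> \<Phi> ` (Sigma P I)" by blast
  qed
  moreover have fin: "finite (Sigma P I)" by (auto simp: P_def I_def)
  ultimately have "card ?Q \<le> card (Sigma P I)" by (rule surj_card_le[rotated])
  also have "\<dots> = (\<Sum>(g, h)\<in>P. (N div max g h) ^ 2)"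
    by (subst card_SigmaI) (auto simp: P_def I_def power2_eq_square intro!: sum.cong)
  finally have "real (card ?Q) \<le> real (\<Sum>(g, h)\<in>P. (N div max g h) ^ 2)" by (simp only: of_nat_le_iff)
  \<comment> \<open>Split by which of \<open>g\<close> and \<open>h\<close> is the larger; the
    diagonal is counted twice, and the two halves are equal by symmetry.\<close>
  also have "\<dots> \<le> (\<Sum>(g, h)\<in>P. (if h \<le> g then real N ^ 2 / real g ^ 2 else 0) + (if g \<le> h then real N ^ 2 / real h ^ 2 else 0))"
    unfolding of_nat_sum
  proof (intro sum_mono)
    fix p assume "p \<in> P"
    obtain g h where p: "p = (g, h)" by (cases p)
    have "real (N div max g h) \<le> real N / real (max g h)" by (rule of_nat_div_le_of_nat)
    then have "real (N div max g h) ^ 2 \<le> (real N / real (max g h)) ^ 2" by (intro power_mono) auto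
    also have "\<dots> \<le> (if h \<le> g then real N ^ 2 / real g ^ 2 else 0) + (if g \<le> h then real N ^ 2 / real h ^ 2 else 0)"
      by (auto simp: max_def power_divide)
    finally show "real (case p of (g, h) \<Rightarrow> (N div max g h)\<^sup>2) \<le> (case p of (g, h) \<Rightarrow> (if h \<le> g then real N ^ 2 / real g ^ 2 else 0) + (if g \<le> h then real N ^ 2 / real h ^ 2 else 0))"
      by (simp add: p)
  qed
  also have "\<dots> = (\<Sum>g=1..N. \<Sum>h=1..N. if h \<le> g then real N ^ 2 / real g ^ 2 else 0) +
      (\<Sum>g=1..N. \<Sum>h=1..N. if g \<le> h then real N ^ 2 / real h ^ 2 else 0)"
    unfolding P_def by (simp add: sum.cartesian_product[symmetric] sum.distrib)
  also have "(\<Sum>g=1..N. \<Sum>h=1..N. if g \<le> h then real N ^ 2 / real h ^ 2 else 0) =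
      (\<Sum>g=1..N. \<Sum>h=1..N. if h \<le> g then real N ^ 2 / real g ^ 2 else 0)"
    by (rule sum.swap)
  also have "(\<Sum>g=1..N. \<Sum>h=1..N. if h \<le> g then real N ^ 2 / real g ^ 2 else 0) = (\<Sum>g=1..N. real N ^ 2 * (1 / real g))"
  proof (intro sum.cong refl)
    fix g assume g: "g \<in> {1..N}"
    \<comment> \<open>There are \<open>g\<close> values of \<open>h\<close> up to \<open>g\<close>,
      so the inverse square becomes \<open>1 / g\<close> and the harmonic sum supplies the
      logarithm.\<close>
    have "(\<Sum>h=1..N. if h \<le> g then real N ^ 2 / real g ^ 2 else 0) = (\<Sum>h=1..g. real N ^ 2 / real g ^ 2)"
      using g by (intro sum.mono_neutral_cong_right) auto
    also have "\<dots> = real N ^ 2 * (1 / real g)" using g by (simp add: power2_eq_square)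
    finally show "(\<Sum>h=1..N. if h \<le> g then real N ^ 2 / real g ^ 2 else 0) = real N ^ 2 * (1 / real g)" .
  qed
  also have "\<dots> = real N ^ 2 * (\<Sum>g=1..N. 1 / real g)" by (simp only: sum_distrib_left)
  also have "\<dots> + \<dots> \<le> real N ^ 2 * (1 + ln N) + real N ^ 2 * (1 + ln N)"
    using sum_inverse_le_ln[OF assms(1)] by (intro add_mono mult_left_mono) auto
  also have "\<dots> = 2 * real N ^ 2 * (1 + ln N)" by simp
  finally show ?thesis .
qed

section \<open>Bilinear sums over a dyadic block\<close>

text \<open>Extension by zero to all moduli, so that sums over \<open>m\<close> can run over full
  intervals while staying multiplicative in \<open>n\<close>.\<close>

definition jacobi_sqfree :: "nat \<Rightarrow> nat \<Rightarrow> real" where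
  "jacobi_sqfree n m = (if odd m \<and> squarefree m then of_int (jacobi (int n) m) else 0)"

lemma jacobi_sqfree_mult: "jacobi_sqfree (a * b) m = jacobi_sqfree a m * jacobi_sqfree b m"
  using jacobi_mult_left[of m "int a" "int b"] by (simp add: jacobi_sqfree_def)

lemma sum_jacobi_sqfree_square_le:
  assumes "finite B" "X > 0" "L > 0" "\<And>m. m \<in> B \<Longrightarrow> m \<le> L"
  shows "(\<Sum>\<nu>=1..X. (\<Sum>m\<in>B. jacobi_sqfree \<nu> m) ^ 2) \<le> (4 * real X + 64 * real L ^ 4 / real X) * card B"
proof -
  define A where "A = {m\<in>B. odd m \<and> squarefree m}"
  have "(\<Sum>m\<in>B. jacobi_sqfree \<nu> m) = (\<Sum>m\<in>A. real_of_int (jacobi (int \<nu>) m))" for \<nu>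
    unfolding A_def jacobi_sqfree_def using assms(1) by (rule sum.inter_filter[symmetric])
  moreover have "(\<Sum>\<nu>=1..X. (\<Sum>m\<in>A. real_of_int (jacobi (int \<nu>) m)) ^ 2)
      \<le> (4 * real X + 64 * real L ^ 4 / real X) * card A"
    using assms by (intro jacobi_large_sieve) (auto simp: A_def)
  ultimately have "(\<Sum>\<nu>=1..X. (\<Sum>m\<in>B. jacobi_sqfree \<nu> m) ^ 2)
      \<le> (4 * real X + 64 * real L ^ 4 / real X) * card A"
    by (simp only:)
  also have "\<dots> \<le> (4 * real X + 64 * real L ^ 4 / real X) * card B"
    using assms(1) by (intro mult_left_mono) (auto simp: A_def intro!: card_mono)
  finally show ?thesis .
qed

text \<open>A majorant for all initial segments of the block at once: it depends on
  \<open>\<nu>\<close> but not on the cut, so it can be averaged over \<open>\<nu>\<close> when the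
  cut varies.\<close>

definition prefix_majorant :: "nat \<Rightarrow> nat \<Rightarrow> real" where
  "prefix_majorant i \<nu> = real (Suc i) *
     (\<Sum>j\<le>i. \<Sum>k<2 ^ (i - j). (\<Sum>t\<in>{k * 2 ^ j..<Suc k * 2 ^ j}. jacobi_sqfree \<nu> (2 ^ i + t)) ^ 2)"

lemma prefix_majorant:
  assumes "y \<le> 2 ^ i"
  shows "(\<Sum>t<y. jacobi_sqfree \<nu> (2 ^ i + t)) ^ 2 \<le> prefix_majorant i \<nu>"
  unfolding prefix_majorant_def using assms by (rule prefix_sum_square_le)

lemma prefix_majorant_nonneg: "prefix_majorant i \<nu> \<ge> 0"
  unfolding prefix_majorant_def by (intro mult_nonneg_nonneg sum_nonneg) auto

text \<open>The large sieve bounds an aligned subblock of length \<open>2 ^ j\<close> by a multiple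
  of \<open>X * 2 ^ j\<close>. The subblocks of one level have total length \<open>2 ^ i\<close>;
  the number of levels and the prefactor each give \<open>Suc i\<close>.\<close>

lemma sum_prefix_majorant_le:
  assumes "(2 ^ i) ^ 2 \<le> X"
  shows "(\<Sum>\<nu>=1..X. prefix_majorant i \<nu>) \<le> 1028 * real (Suc i) ^ 2 * real X * 2 ^ i"
proof -
  define L :: nat where "L = 2 * 2 ^ i"
  have "X > 0" using assms by (auto intro: Nat.gr0I)
  \<comment> \<open>With \<open>L = 2 * 2 ^ i\<close> and \<open>(2 ^ i)\<^sup>2 \<le> X\<close> the
    second term is at most 64 * 16 times \<open>X\<close>, and 4 + 1024 = 1028.\<close>
  have X: "4 * real X + 64 * real L ^ 4 / real X \<le> 1028 * real X"
  proof -
    have "real ((2 ^ i) ^ 2) \<le> real X" using assms by (simp only: of_nat_le_iff)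
    then have "real ((2 ^ i) ^ 2) ^ 2 \<le> real X ^ 2" by (intro power_mono) auto
    then have "real L ^ 4 \<le> 16 * real X ^ 2"
      by (simp add: L_def power_mult_distrib mult.commute flip: power_mult)
    then have "64 * real L ^ 4 / real X \<le> 64 * (16 * real X ^ 2) / real X"
      using \<open>X > 0\<close> by (intro divide_right_mono mult_left_mono) auto
    also have "\<dots> = 1024 * real X" using \<open>X > 0\<close> by (simp add: power2_eq_square)
    finally show ?thesis by simp
  qed
  have block: "(\<Sum>\<nu>=1..X. (\<Sum>t\<in>{k * 2 ^ j..<Suc k * 2 ^ j}. jacobi_sqfree \<nu> (2 ^ i + t)) ^ 2) \<le> 1028 * real X * 2 ^ j"
    if jk: "j \<le> i" "k < 2 ^ (i - j)" for j k
  proof -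
    define B where "B = (\<lambda>t. 2 ^ i + t) ` {k * 2 ^ j..<Suc k * 2 ^ j}"
    have "Suc k * 2 ^ j \<le> 2 ^ (i - j) * 2 ^ j" using jk by (intro mult_right_mono) auto
    then have "Suc k * 2 ^ j \<le> 2 ^ i" using jk by (simp flip: power_add)
    then have B_le: "m \<le> L" if "m \<in> B" for m using that by (auto simp: B_def L_def)
    have "(\<Sum>t\<in>{k * 2 ^ j..<Suc k * 2 ^ j}. jacobi_sqfree \<nu> (2 ^ i + t)) = (\<Sum>m\<in>B. jacobi_sqfree \<nu> m)" for \<nu>
      unfolding B_def by (subst sum.reindex) (auto simp: inj_on_def)
    then have "(\<Sum>\<nu>=1..X. (\<Sum>t\<in>{k * 2 ^ j..<Suc k * 2 ^ j}. jacobi_sqfree \<nu> (2 ^ i + t)) ^ 2)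
      \<le> (4 * real X + 64 * real L ^ 4 / real X) * card B"
      using sum_jacobi_sqfree_square_le[of B X L] B_le \<open>X > 0\<close> by (simp add: B_def L_def)
    also have "card B = 2 ^ j" unfolding B_def by (subst card_image) (auto simp: inj_on_def)
    also have "(4 * real X + 64 * real L ^ 4 / real X) * real (2 ^ j) \<le> 1028 * real X * real (2 ^ j)"
      using X by (intro mult_right_mono) auto
    finally show ?thesis by simp
  qed
  have "(\<Sum>\<nu>=1..X. prefix_majorant i \<nu>) = real (Suc i) * (\<Sum>j\<le>i. \<Sum>k<2 ^ (i - j). \<Sum>\<nu>=1..X.
      (\<Sum>t\<in>{k * 2 ^ j..<Suc k * 2 ^ j}. jacobi_sqfree \<nu> (2 ^ i + t)) ^ 2)"
    unfolding prefix_majorant_def sum_distrib_left[symmetric]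
  proof (rule arg_cong[where f = "\<lambda>x. real (Suc i) * x"])
    let ?F = "\<lambda>\<nu> j k. (\<Sum>t\<in>{k * 2 ^ j..<Suc k * 2 ^ j}. jacobi_sqfree \<nu> (2 ^ i + t)) ^ 2"
    have "(\<Sum>\<nu>=1..X. \<Sum>j\<le>i. \<Sum>k<2 ^ (i - j). ?F \<nu> j k) = (\<Sum>j\<le>i. \<Sum>\<nu>=1..X. \<Sum>k<2 ^ (i - j). ?F \<nu> j k)"
      by (rule sum.swap)
    also have "\<dots> = (\<Sum>j\<le>i. \<Sum>k<2 ^ (i - j). \<Sum>\<nu>=1..X. ?F \<nu> j k)"
      by (intro sum.cong refl sum.swap)
    finally show "(\<Sum>\<nu>=1..X. \<Sum>j\<le>i. \<Sum>k<2 ^ (i - j). ?F \<nu> j k) = \<dots>" .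
  qed
  also have "\<dots> \<le> real (Suc i) * (\<Sum>j\<le>i. \<Sum>k<(2::nat) ^ (i - j). 1028 * real X * 2 ^ j)"
    by (intro mult_left_mono sum_mono block) auto
  also have "(\<Sum>j\<le>i. \<Sum>k<(2::nat) ^ (i - j). 1028 * real X * 2 ^ j) = (\<Sum>j\<le>i. 1028 * real X * 2 ^ i)"
  proof (intro sum.cong refl)
    fix j assume "j \<in> {..i}"
    then have "(2::real) ^ i = 2 ^ (i - j) * 2 ^ j" by (simp flip: power_add)
    then show "(\<Sum>k<(2::nat) ^ (i - j). 1028 * real X * 2 ^ j) = 1028 * real X * 2 ^ i" by simp
  qed
  also have "real (Suc i) * \<dots> = 1028 * real (Suc i) ^ 2 * real X * 2 ^ i"
    by (simp add: power2_eq_square)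
  finally show ?thesis .
qed

text \<open>For fixed \<open>x\<close> the condition \<open>m * x \<le> T\<close> cuts an initial
  segment out of the block.\<close>

lemma sum_restricted_le_majorant:
  assumes "x > 0"
  shows "\<bar>\<Sum>m\<in>{m\<in>{2 ^ i..<2 * 2 ^ i}. real m * x \<le> T}. jacobi_sqfree \<nu> m\<bar> \<le> sqrt (prefix_majorant i \<nu>)"
proof -
  define Q where "Q = T / x"
  \<comment> \<open>The number of block elements up to \<open>Q\<close>; truncated subtraction gives
    0 when the floor of \<open>Q\<close> lies below \<open>2 ^ i\<close>.\<close>
  define y where "y = (if Q < 0 then 0 else min (2 ^ i) (Suc (nat \<lfloor>Q\<rfloor>) - 2 ^ i))"
  have "{m\<in>{2 ^ i..<2 * 2 ^ i}. real m * x \<le> T} = (\<lambda>t. 2 ^ i + t) ` {..<y}"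
  proof -
    have iff: "real m * x \<le> T \<longleftrightarrow> Q \<ge> 0 \<and> m \<le> nat \<lfloor>Q\<rfloor>" for m
    proof -
      have "real m * x \<le> T \<longleftrightarrow> real m \<le> Q" using assms by (simp add: Q_def field_simps)
      also have "\<dots> \<longleftrightarrow> Q \<ge> 0 \<and> m \<le> nat \<lfloor>Q\<rfloor>"
        by (cases "Q \<ge> 0") (auto simp: le_nat_iff le_floor_iff)
      finally show ?thesis .
    qed
    have mem: "2 ^ i + t \<in> {m\<in>{2 ^ i..<2 * 2 ^ i}. real m * x \<le> T} \<longleftrightarrow> t < y" for t
      unfolding mem_Collect_eq iff y_def by (cases "Q < 0") (simp_all, linarith)
    show ?thesis
    proof (intro equalityI subsetI)
      fix m assume m: "m \<in> {m\<in>{2 ^ i..<2 * 2 ^ i}. real m * x \<le> T}"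
      then have "m = 2 ^ i + (m - 2 ^ i)" by simp
      then show "m \<in> (\<lambda>t. 2 ^ i + t) ` {..<y}"
        using m mem[of "m - 2 ^ i"] by (metis image_eqI lessThan_iff)
    next
      fix m assume "m \<in> (\<lambda>t. 2 ^ i + t) ` {..<y}"
      then show "m \<in> {m\<in>{2 ^ i..<2 * 2 ^ i}. real m * x \<le> T}" using mem by blast
    qed
  qed
  then have "(\<Sum>m\<in>{m\<in>{2 ^ i..<2 * 2 ^ i}. real m * x \<le> T}. jacobi_sqfree \<nu> m) = (\<Sum>t<y. jacobi_sqfree \<nu> (2 ^ i + t))"
    by (simp add: sum.reindex inj_on_def)
  moreover have "sqrt ((\<Sum>t<y. jacobi_sqfree \<nu> (2 ^ i + t)) ^ 2) \<le> sqrt (prefix_majorant i \<nu>)"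
    by (intro real_sqrt_le_mono prefix_majorant) (auto simp: y_def)
  ultimately show ?thesis by (simp only: real_sqrt_abs)
qed

text \<open>The fourth power comes from two uses of Cauchy-Schwarz, first over \<open>m\<close> and
  then over the products of two values of \<open>n\<close>. The constant is 2 from the energy times
  1028 from the majorant.\<close>

lemma dyadic_bilinear_le:
  fixes \<alpha> \<beta> :: "nat \<Rightarrow> complex"
  assumes M: "M = 2 ^ i" "real M ^ 2 \<le> T"
    and N: "N = nat \<lfloor>T / real M\<rfloor>"
    and \<alpha>: "\<And>n. n \<ge> 1 \<Longrightarrow> n \<le> N \<Longrightarrow> norm (\<alpha> n) \<le> 1"
    and \<beta>: "\<And>m. M \<le> m \<Longrightarrow> m < 2 * M \<Longrightarrow> norm (\<beta> m) \<le> 1"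
  shows "norm (\<Sum>m\<in>{M..<2 * M}. \<Sum>n\<in>{n\<in>{1..N}. real m * real n \<le> T}. \<alpha> n * \<beta> m * of_real (jacobi_sqfree n m)) ^ 4
    \<le> 2056 * real M ^ 3 * real N ^ 4 * (1 + ln N) * real (Suc i) ^ 2"
proof -
  have "M > 0" by (simp add: M)
  define I where "I m = {n\<in>{1..N}. real m * real n \<le> T}" for m
  define A where "A m = (\<Sum>n\<in>I m. \<alpha> n * of_real (jacobi_sqfree n m))" for m
  define S where "S = (\<Sum>m\<in>{M..<2 * M}. \<Sum>n\<in>I m. \<alpha> n * \<beta> m * of_real (jacobi_sqfree n m))"
  define P where "P = {1..N} \<times> {1..N}"
  \<comment> \<open>From \<open>M \<le> N\<close> the range \<open>X = N\<^sup>2\<close> is long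
    enough for \<open>sum_prefix_majorant_le\<close>.\<close>
  have "real M \<le> T / real M" using M(2) \<open>M > 0\<close> by (simp add: field_simps power2_eq_square)
  then have "M \<le> N" by (simp add: N le_nat_floor)
  then have "N > 0" "M ^ 2 \<le> N ^ 2" using \<open>M > 0\<close> by (auto intro: power_mono)
  have "S = (\<Sum>m\<in>{M..<2 * M}. \<beta> m * A m)"
    by (simp add: S_def A_def sum_distrib_left mult_ac)
  then have "norm S \<le> (\<Sum>m\<in>{M..<2 * M}. norm (\<beta> m * A m))" by (simp add: norm_sum)
  also have "\<dots> \<le> (\<Sum>m\<in>{M..<2 * M}. 1 * norm (A m))"
    using \<beta> by (intro sum_mono) (auto simp: norm_mult intro!: mult_left_le_one_le)
  finally have "norm S ^ 2 \<le> (\<Sum>m\<in>{M..<2 * M}. 1 * norm (A m)) ^ 2" by (intro power_mono) auto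
  also have "\<dots> \<le> (\<Sum>m\<in>{M..<2 * M}. 1 ^ 2) * (\<Sum>m\<in>{M..<2 * M}. norm (A m) ^ 2)"
    by (rule Cauchy_Schwarz_ineq_sum)
  finally have S_le: "norm S ^ 2 \<le> real M * (\<Sum>m\<in>{M..<2 * M}. norm (A m) ^ 2)" by simp

  have "complex_of_real (\<Sum>m\<in>{M..<2 * M}. norm (A m) ^ 2) =
    (\<Sum>m\<in>{M..<2 * M}. \<Sum>p\<in>I m \<times> I m. \<alpha> (fst p) * cnj (\<alpha> (snd p)) * of_real (jacobi_sqfree (fst p * snd p) m))"
    unfolding of_real_sum complex_norm_square A_def cnj_sum sum_product
    by (intro sum.cong refl) (simp add: sum.cartesian_product case_prod_unfold jacobi_sqfree_mult mult_ac)
  also have "\<dots> = (\<Sum>m\<in>{M..<2 * M}. \<Sum>p\<in>{p\<in>P. real m * real (max (fst p) (snd p)) \<le> T}.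
      \<alpha> (fst p) * cnj (\<alpha> (snd p)) * of_real (jacobi_sqfree (fst p * snd p) m))"
  proof (intro sum.cong refl)
    fix m
    \<comment> \<open>The two hyperbolic conditions merge into one on the maximum, so after the
      interchange \<open>m\<close> still runs over an initial segment of the block.\<close>
    have "real m * real (max a b) \<le> T \<longleftrightarrow> real m * real a \<le> T \<and> real m * real b \<le> T" for a b
    proof (cases "a \<le> b")
      case True
      then have "real m * real a \<le> real m * real b" by (intro mult_left_mono) auto
      then show ?thesis using True by (auto simp: max_def)
    next
      case False
      then have "real m * real b \<le> real m * real a" by (intro mult_left_mono) auto
      then show ?thesis using False by (auto simp: max_def)
    qed
    then show "I m \<times> I m = {p\<in>P. real m * real (max (fst p) (snd p)) \<le> T}"
      by (auto simp: I_def P_def)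
  qed
  also have "\<dots> = (\<Sum>p\<in>P. \<Sum>m\<in>{m\<in>{M..<2 * M}. real m * real (max (fst p) (snd p)) \<le> T}.
      \<alpha> (fst p) * cnj (\<alpha> (snd p)) * of_real (jacobi_sqfree (fst p * snd p) m))"
    by (rule sum.swap_restrict) (auto simp: P_def)
  also have "\<dots> = (\<Sum>p\<in>P. \<alpha> (fst p) * cnj (\<alpha> (snd p)) *
      of_real (\<Sum>m\<in>{m\<in>{M..<2 * M}. real m * real (max (fst p) (snd p)) \<le> T}. jacobi_sqfree (fst p * snd p) m))"
    by (simp add: sum_distrib_left)
  finally have "norm (complex_of_real (\<Sum>m\<in>{M..<2 * M}. norm (A m) ^ 2)) \<le> (\<Sum>p\<in>P. norm (\<alpha> (fst p) * cnj (\<alpha> (snd p)) *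
      of_real (\<Sum>m\<in>{m\<in>{M..<2 * M}. real m * real (max (fst p) (snd p)) \<le> T}. jacobi_sqfree (fst p * snd p) m)))"
    by (simp only: norm_sum)
  also have "\<dots> \<le> (\<Sum>p\<in>P. sqrt (prefix_majorant i (fst p * snd p)))"
  proof (intro sum_mono)
    fix p assume p: "p \<in> P"
    let ?s = "\<Sum>m\<in>{m\<in>{M..<2 * M}. real m * real (max (fst p) (snd p)) \<le> T}. jacobi_sqfree (fst p * snd p) m"
    have "norm (\<alpha> (fst p)) * norm (\<alpha> (snd p)) \<le> 1 * 1"
      using p by (intro mult_mono \<alpha>) (auto simp: P_def)
    then have "(norm (\<alpha> (fst p)) * norm (\<alpha> (snd p))) * \<bar>?s\<bar> \<le> 1 * \<bar>?s\<bar>"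
      by (intro mult_right_mono) auto
    then have "norm (\<alpha> (fst p) * cnj (\<alpha> (snd p)) * of_real ?s) \<le> \<bar>?s\<bar>"
      by (simp only: norm_mult complex_mod_cnj norm_of_real mult_1_left)
    also have "\<dots> \<le> sqrt (prefix_majorant i (fst p * snd p))"
      unfolding M(1) using p by (intro sum_restricted_le_majorant) (auto simp: P_def)
    finally show "norm (\<alpha> (fst p) * cnj (\<alpha> (snd p)) * of_real ?s) \<le> sqrt (prefix_majorant i (fst p * snd p))" .
  qed
  finally have A_le: "(\<Sum>m\<in>{M..<2 * M}. norm (A m) ^ 2) \<le> (\<Sum>p\<in>P. sqrt (prefix_majorant i (fst p * snd p)))"
    by (simp only: norm_of_real)

  \<comment> \<open>The majorant sees a pair only through its product, so Cauchy-Schwarz over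
    products separates the energy of \<open>{1..N}\<close> from the large sieve.\<close>
  have "(\<Sum>p\<in>P. sqrt (prefix_majorant i (fst p * snd p))) ^ 2 \<le>
    real (card {(p, q). p \<in> P \<and> q \<in> P \<and> fst p * snd p = fst q * snd q}) * (\<Sum>\<nu>=1..N^2. sqrt (prefix_majorant i \<nu>) ^ 2)"
    by (rule sum_fibers_Cauchy_Schwarz[of P "{1..N^2}" "\<lambda>p. fst p * snd p" "\<lambda>\<nu>. sqrt (prefix_majorant i \<nu>)"])
       (auto simp: P_def power2_eq_square intro: mult_mono)
  also have "(\<Sum>\<nu>=1..N^2. sqrt (prefix_majorant i \<nu>) ^ 2) = (\<Sum>\<nu>=1..N^2. prefix_majorant i \<nu>)"
    by (simp add: prefix_majorant_nonneg)
  also have "real (card {(p, q). p \<in> P \<and> q \<in> P \<and> fst p * snd p = fst q * snd q}) * (\<Sum>\<nu>=1..N^2. prefix_majorant i \<nu>) \<le>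
    (2 * real N ^ 2 * (1 + ln N)) * (1028 * real (Suc i) ^ 2 * real (N ^ 2) * 2 ^ i)"
    using \<open>N > 0\<close> \<open>M ^ 2 \<le> N ^ 2\<close> unfolding P_def M(1)
    by (intro mult_mono card_multiplicative_energy_le sum_prefix_majorant_le)
       (auto intro!: sum_nonneg prefix_majorant_nonneg mult_nonneg_nonneg)
  also have "\<dots> = 2056 * real M * real N ^ 4 * (1 + ln N) * real (Suc i) ^ 2"
  proof -
    have "(2 * x * l) * (1028 * s * x * m) = 2056 * m * x ^ 2 * l * s" for x l s m :: real
      by (simp add: power2_eq_square)
    from this[of "real N ^ 2"] show ?thesis by (simp add: M(1) del: of_nat_Suc flip: power_mult)
  qed
  finally have E: "(\<Sum>p\<in>P. sqrt (prefix_majorant i (fst p * snd p))) ^ 2 \<le>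
    2056 * real M * real N ^ 4 * (1 + ln N) * real (Suc i) ^ 2" .

  have "norm S ^ 4 = (norm S ^ 2) ^ 2" by (simp flip: power_mult)
  also have "\<dots> \<le> (real M * (\<Sum>p\<in>P. sqrt (prefix_majorant i (fst p * snd p)))) ^ 2"
    using A_le by (intro power_mono order.trans[OF S_le] mult_left_mono) auto
  also have "\<dots> \<le> real M ^ 2 * (2056 * real M * real N ^ 4 * (1 + ln N) * real (Suc i) ^ 2)"
    unfolding power_mult_distrib by (intro mult_left_mono E) auto
  also have "\<dots> = 2056 * real M ^ 3 * real N ^ 4 * (1 + ln N) * real (Suc i) ^ 2"
    by (simp add: power3_eq_cube power2_eq_square mult_ac)
  finally show ?thesis by (simp add: S_def I_def)
qed

lemma half_le_ln:
  assumes "T \<ge> (2::real)"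
  shows "1 / 2 \<le> ln T"
proof -
  have "1 - 1 / 2 \<le> ln (2::real)" using ln_le_minus_one[of "1/2::real"]
    by (simp add: ln_div)
  also have "ln 2 \<le> ln T" using assms by simp
  finally show ?thesis by simp
qed

text \<open>Write \<open>n * m\<close> as \<open>2 * T\<close> times the ratios
  \<open>n / (T / M)\<close> and \<open>m / (2 * M)\<close>. Both are at most 1 and
  \<open>c \<ge> 0\<close>, so their powers can be absorbed into the coefficients and only
  \<open>(2 * T) powr c\<close> remains outside.\<close>

lemma weighted_dyadic_bilinear_le:
  fixes a b :: "nat \<Rightarrow> complex"
  assumes "c \<ge> 0" "T \<ge> 2" and M: "M = 2 ^ i" "real M ^ 2 \<le> T"
    and a: "\<And>n. n \<ge> 1 \<Longrightarrow> norm (a n) \<le> 1" and b: "\<And>m. m \<ge> 1 \<Longrightarrow> norm (b m) \<le> 1"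
  shows "norm (\<Sum>m\<in>{M..<2 * M}. \<Sum>n\<in>{n. n \<ge> 1 \<and> real m * real n \<le> T}.
           of_real ((real n * real m) powr c) * a n * b m * of_real (jacobi_sqfree n m))
    \<le> (2 * T) powr c * (19 * T * ln T / real M powr (1 / 4))"
proof -
  define N where "N = nat \<lfloor>T / real M\<rfloor>"
  define \<alpha> where "\<alpha> n = a n * of_real ((real n / (T / real M)) powr c)" for n
  define \<beta> where "\<beta> m = b m * of_real ((real m / (2 * real M)) powr c)" for m
  define S where "S = (\<Sum>m\<in>{M..<2 * M}. \<Sum>n\<in>{n\<in>{1..N}. real m * real n \<le> T}. \<alpha> n * \<beta> m * of_real (jacobi_sqfree n m))"
  have "M > 0" by (simp add: M)
  have "T > 0" using assms by simp
  have "real M \<le> T / real M" using M(2) \<open>M > 0\<close> by (simp add: field_simps power2_eq_square)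
  then have "M \<le> N" by (simp add: N_def le_nat_floor)
  then have "N > 0" using \<open>M > 0\<close> by simp
  have N_le: "real N \<le> T / real M" using \<open>T > 0\<close> unfolding N_def by simp
  have \<alpha>: "norm (\<alpha> n) \<le> 1" if "n \<ge> 1" "n \<le> N" for n
  proof -
    have "real n \<le> T / real M" using that N_le by linarith
    then have "(real n / (T / real M)) powr c \<le> 1 powr c"
      using \<open>T > 0\<close> \<open>M > 0\<close> assms(1) by (intro powr_mono2) (auto simp: field_simps)
    then have "norm (a n) * (real n / (T / real M)) powr c \<le> 1 * 1"
      using a[OF that(1)] by (intro mult_mono) auto
    then show ?thesis by (simp add: \<alpha>_def norm_mult)
  qed
  have \<beta>: "norm (\<beta> m) \<le> 1" if "M \<le> m" "m < 2 * M" for m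
  proof -
    have "(real m / (2 * real M)) powr c \<le> 1 powr c"
      using that assms(1) by (intro powr_mono2) (auto simp: field_simps)
    then have "norm (b m) * (real m / (2 * real M)) powr c \<le> 1 * 1"
      using b[of m] that \<open>M > 0\<close> by (intro mult_mono) auto
    then show ?thesis by (simp add: \<beta>_def norm_mult)
  qed
  have "(\<Sum>m\<in>{M..<2 * M}. \<Sum>n\<in>{n. n \<ge> 1 \<and> real m * real n \<le> T}.
           of_real ((real n * real m) powr c) * a n * b m * of_real (jacobi_sqfree n m)) =
    of_real ((2 * T) powr c) * S"
    unfolding S_def sum_distrib_left
  proof (intro sum.cong)
    fix m assume m: "m \<in> {M..<2 * M}"
    show "{n. n \<ge> 1 \<and> real m * real n \<le> T} = {n\<in>{1..N}. real m * real n \<le> T}"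
    proof -
      have "n \<le> N" if "real m * real n \<le> T" for n
      proof -
        have "real M * real n \<le> real m * real n" using m by (intro mult_right_mono) auto
        then have "real n \<le> T / real M" using that \<open>M > 0\<close> by (simp add: field_simps)
        then show ?thesis unfolding N_def by (simp add: le_nat_floor)
      qed
      then show ?thesis by auto
    qed
    fix n assume "n \<in> {n\<in>{1..N}. real m * real n \<le> T}"
    have "real n * real m = (2 * T) * (real n / (T / real M)) * (real m / (2 * real M))"
      using \<open>T > 0\<close> \<open>M > 0\<close> by (simp add: field_simps)
    then have "(real n * real m) powr c = (2 * T) powr c * (real n / (T / real M)) powr c * (real m / (2 * real M)) powr c"
      using \<open>T > 0\<close> by (simp only: powr_mult)
    then show "of_real ((real n * real m) powr c) * a n * b m * of_real (jacobi_sqfree n m) =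
      of_real ((2 * T) powr c) * (\<alpha> n * \<beta> m * of_real (jacobi_sqfree n m))"
      by (simp only: \<alpha>_def \<beta>_def of_real_mult mult_ac)
  qed auto
  then have eq: "norm (\<Sum>m\<in>{M..<2 * M}. \<Sum>n\<in>{n. n \<ge> 1 \<and> real m * real n \<le> T}.
           of_real ((real n * real m) powr c) * a n * b m * of_real (jacobi_sqfree n m)) = (2 * T) powr c * norm S"
    by (simp add: norm_mult)

  have lnT: "1 / 2 \<le> ln T" using assms(2) by (rule half_le_ln)
  then have lnT_nonneg: "0 \<le> ln T" by linarith
  have "ln (real N) \<le> ln T"
  proof -
    have "T / real M \<le> T / 1" using \<open>M > 0\<close> \<open>T > 0\<close> by (intro divide_left_mono) auto
    then show ?thesis using N_le \<open>N > 0\<close> by simp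
  qed
  then have 1: "1 + ln (real N) \<le> 3 * ln T" using lnT by simp
  have "real i \<le> ln T"
  proof -
    have "(2::real) ^ (2 * i) \<le> T" using M by (simp add: power_mult[symmetric] mult.commute)
    then have "ln ((2::real) ^ (2 * i)) \<le> ln T" using \<open>T > 0\<close> by (intro ln_mono) auto
    then have "real i * (2 * ln 2) \<le> ln T" by (simp add: ln_realpow)
    moreover have "real i * 1 \<le> real i * (2 * ln 2)" using half_le_ln[of 2] by (intro mult_left_mono) auto
    ultimately show ?thesis by linarith
  qed
  then have 2: "real (Suc i) \<le> 3 * ln T" using lnT by simp
  have "norm S ^ 4 \<le> 2056 * real M ^ 3 * real N ^ 4 * (1 + ln N) * real (Suc i) ^ 2"
    unfolding S_def using M N_def \<alpha> \<beta> by (intro dyadic_bilinear_le) auto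
  also have "\<dots> \<le> 2056 * real M ^ 3 * (T / real M) ^ 4 * (3 * ln T) * (3 * ln T) ^ 2"
    using 1 2 N_le \<open>N > 0\<close> lnT_nonneg \<open>T > 0\<close>
    by (intro mult_mono power_mono mult_nonneg_nonneg zero_le_power) auto
  \<comment> \<open>Here 55512 = 2056 * 27, the three factors \<open>3 * ln T\<close> giving
    27.\<close>
  also have "\<dots> = 55512 * (T ^ 4 / real M) * ln T ^ 3"
    using \<open>M > 0\<close> by (simp add: field_simps power2_eq_square power3_eq_cube power4_eq_xxxx)
  \<comment> \<open>Since \<open>ln T \<ge> 1 / 2\<close>, a cube of the logarithm may be traded for
    twice its fourth power, which prepares a clean fourth root.\<close>
  also have "\<dots> \<le> 55512 * (T ^ 4 / real M) * (2 * ln T ^ 4)"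
  proof (intro mult_left_mono)
    have "ln T ^ 3 * 1 \<le> ln T ^ 3 * (2 * ln T)" using lnT lnT_nonneg by (intro mult_left_mono) auto
    also have "\<dots> = 2 * ln T ^ 4" by (simp add: power3_eq_cube power4_eq_xxxx)
    finally show "ln T ^ 3 \<le> 2 * ln T ^ 4" by simp
  qed (use \<open>T > 0\<close> in auto)
  also have "\<dots> = 111024 * (T ^ 4 * ln T ^ 4 / real M)" by simp
  \<comment> \<open>19 is the least integer whose fourth power, 130321, exceeds 111024.\<close>
  also have "\<dots> \<le> 19 ^ 4 * (T ^ 4 * ln T ^ 4 / real M)" by (intro mult_right_mono) auto
  also have "\<dots> = (19 * T * ln T / real M powr (1 / 4)) ^ 4"
  proof -
    have "(real M powr (1 / 4)) ^ 4 = real M" using \<open>M > 0\<close> by (simp add: powr_power)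
    then show ?thesis by (simp add: power_divide power_mult_distrib)
  qed
  finally have "norm S ^ 4 \<le> (19 * T * ln T / real M powr (1 / 4)) ^ 4" .
  moreover have "0 \<le> 19 * T * ln T / real M powr (1 / 4)"
    using lnT_nonneg \<open>T > 0\<close> by (intro divide_nonneg_nonneg mult_nonneg_nonneg) auto
  ultimately have "norm S \<le> 19 * T * ln T / real M powr (1 / 4)"
    using power_mono_iff[of "norm S" _ 4] by simp
  then show ?thesis unfolding eq by (intro mult_left_mono) auto
qed

section \<open>Summation over dyadic blocks\<close>

text \<open>A geometric series dominated by its first term, at the least index \<open>i0\<close>,
  for which \<open>2 ^ i0 > z / 2\<close>.\<close>

lemma sum_dyadic_powr_le:
  assumes "finite I" "z > 0" "\<And>i. i \<in> I \<Longrightarrow> z < 2 ^ Suc i"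
  shows "(\<Sum>i\<in>I. 1 / ((2::real) ^ i) powr (1 / 4)) \<le> 16 / z powr (1 / 4)"
proof (cases "I = {}")
  case False
  define r where "r = (2::real) powr (- (1 / 4))"
  define i0 where "i0 = Min I"
  have i0: "i0 \<in> I" "\<And>i. i \<in> I \<Longrightarrow> i0 \<le> i" using False assms(1) by (simp_all add: i0_def)
  have r_power: "1 / ((2::real) ^ i) powr (1 / 4) = r ^ i" for i
  proof -
    have "((2::real) ^ i) powr (1 / 4) = 2 powr (real i / 4)"
      by (simp add: powr_powr flip: powr_realpow)
    moreover have "r ^ i = 2 powr (- (real i / 4))"
      by (simp add: r_def powr_power)
    ultimately show ?thesis by (simp add: powr_minus_divide)
  qed
  have "r > 0" by (simp add: r_def)
  \<comment> \<open>The ratio is the inverse fourth root of 2. Its bound 7/8 makes the series at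
    most 8, and replacing \<open>2 ^ i0\<close> by \<open>z\<close> costs at most a further factor
    2.\<close>
  have "r ^ 4 = 2 powr (- 1)" unfolding r_def by (simp add: powr_power)
  also have "\<dots> \<le> (7 / 8) ^ 4" by (simp add: powr_minus power4_eq_xxxx)
  finally have "r \<le> 7 / 8" using \<open>r > 0\<close> power_mono_iff[of r "7 / 8" 4] by simp
  have "(\<Sum>i\<in>I. r ^ i) = (\<Sum>j\<in>(\<lambda>i. i - i0) ` I. r ^ i0 * r ^ j)"
  proof (subst sum.reindex)
    show "inj_on (\<lambda>i. i - i0) I" using i0(2) by (auto simp: inj_on_def intro: eq_diff_iff[THEN iffD1])
    show "(\<Sum>i\<in>I. r ^ i) = (\<Sum>i\<in>I. ((\<lambda>j. r ^ i0 * r ^ j) \<circ> (\<lambda>i. i - i0)) i)"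
      using i0(2) by (intro sum.cong) (simp_all flip: power_add)
  qed
  also have "\<dots> = r ^ i0 * (\<Sum>j\<in>(\<lambda>i. i - i0) ` I. r ^ j)" by (simp only: sum_distrib_left)
  also have "\<dots> \<le> r ^ i0 * (\<Sum>j. r ^ j)"
    using assms(1) \<open>r > 0\<close> \<open>r \<le> 7 / 8\<close> by (intro mult_left_mono sum_le_suminf summable_geometric) auto
  also have "(\<Sum>j. r ^ j) = 1 / (1 - r)" using \<open>r > 0\<close> \<open>r \<le> 7 / 8\<close> by (intro suminf_geometric) auto
  also have "r ^ i0 * (1 / (1 - r)) \<le> r ^ i0 * 8"
    using \<open>r > 0\<close> \<open>r \<le> 7 / 8\<close> by (intro mult_left_mono) (auto simp: field_simps)
  also have "r ^ i0 * 8 = 8 / ((2::real) ^ i0) powr (1 / 4)" by (simp flip: r_power)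
  also have "\<dots> \<le> 8 / (z powr (1 / 4) / 2)"
  proof (intro divide_left_mono)
    have "z powr (1 / 4) \<le> (2 * 2 ^ i0) powr (1 / 4)" using assms(2) assms(3)[OF i0(1)] by (intro powr_mono2) auto
    also have "\<dots> = 2 powr (1 / 4) * (2 ^ i0) powr (1 / 4)" by (simp add: powr_mult)
    also have "\<dots> \<le> 2 powr 1 * (2 ^ i0) powr (1 / 4)" by (intro mult_right_mono powr_mono) auto
    finally show "z powr (1 / 4) / 2 \<le> (2 ^ i0) powr (1 / 4)" by simp
  qed (use assms(2) in auto)
  also have "\<dots> = 16 / z powr (1 / 4)" by simp
  finally show ?thesis by (simp only: r_power)
qed simp

text \<open>The part with \<open>m\<close> up to the square root of \<open>T\<close>. No lower
  bound, parity or square-freeness is imposed on \<open>n\<close>: such conditions are to be encoded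
  by letting \<open>a\<close> vanish.\<close>

definition half_sum :: "real \<Rightarrow> real \<Rightarrow> real \<Rightarrow> (nat \<Rightarrow> complex) \<Rightarrow> (nat \<Rightarrow> complex) \<Rightarrow> complex" where
  "half_sum c T z a b = (\<Sum>m\<in>{m. z < real m \<and> real m ^ 2 \<le> T}. \<Sum>n\<in>{n. n \<ge> 1 \<and> real m * real n \<le> T}.
     of_real ((real n * real m) powr c) * a n * b m * of_real (jacobi_sqfree n m))"

lemma finite_nat_real_le: "finite {n. real n \<le> x}"
proof (rule finite_subset)
  show "{n. real n \<le> x} \<subseteq> {..nat \<lfloor>x\<rfloor>}" by (auto simp: le_nat_floor)
qed simp

lemma real_le_square: "real m \<le> real m ^ 2"
  by (cases m) (auto simp: power2_eq_square)

lemma norm_half_sum_le: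
  assumes "c \<ge> 0" "T \<ge> 2" "z \<ge> 2"
    and a: "\<And>n. n \<ge> 1 \<Longrightarrow> norm (a n) \<le> 1" and b: "\<And>m. m \<ge> 1 \<Longrightarrow> norm (b m) \<le> 1"
  shows "norm (half_sum c T z a b) \<le> 304 * 2 powr c * (T powr (1 + c) * ln T / z powr (1 / 4))"
proof -
  define Ms where "Ms = {m. z < real m \<and> real m ^ 2 \<le> T}"
  define f where "f b m = (\<Sum>n\<in>{n. n \<ge> 1 \<and> real m * real n \<le> T}.
     of_real ((real n * real m) powr c) * a n * b m * of_real (jacobi_sqfree n m))" for b m
  \<comment> \<open>Vanishing outside \<open>Ms\<close> lets the sum be extended to complete dyadic
    blocks.\<close>
  define b' where "b' m = (if m \<in> Ms then b m else 0)" for m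
  \<comment> \<open>The exponents whose block can meet \<open>Ms\<close>; the second condition is
    the size hypothesis of the block estimate.\<close>
  define I where "I = {i. z < 2 ^ Suc i \<and> real (2 ^ i) ^ 2 \<le> T}"
  have "finite I"
  proof (rule finite_subset)
    show "I \<subseteq> {i. real i \<le> T}"
    proof
      fix i assume "i \<in> I"
      have "real i \<le> real (2 ^ i)" using less_exp[of i] by (simp only: of_nat_le_iff)
      also have "\<dots> \<le> real (2 ^ i) ^ 2" by (rule real_le_square)
      also have "\<dots> \<le> T" using \<open>i \<in> I\<close> by (simp add: I_def)
      finally show "i \<in> {i. real i \<le> T}" by simp
    qed
  qed (rule finite_nat_real_le)
  have sub: "Ms \<subseteq> (\<Union>i\<in>I. {2 ^ i..<2 * 2 ^ i})"
  proof
    fix m assume m: "m \<in> Ms"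
    then have "1 \<le> m" using assms(3) by (cases m) (auto simp: Ms_def)
    then obtain i where i: "2 ^ i \<le> m" "m < 2 ^ (i + 1)" using ex_power_ivl1[of 2 m] by auto
    have "real (2 ^ i) ^ 2 \<le> real m ^ 2" using i(1) by (intro power_mono) (simp_all only: of_nat_le_iff of_nat_0_le_iff)
    moreover have "real m < real (2 ^ (i + 1))" using i(2) by (simp only: of_nat_less_iff)
    moreover have "real m ^ 2 \<le> T" "z < real m" using m by (simp_all add: Ms_def)
    ultimately have "real (2 ^ i) ^ 2 \<le> T" "z < real (2 ^ (i + 1))" by linarith+
    then have "i \<in> I" by (simp add: I_def)
    then show "m \<in> (\<Union>i\<in>I. {2 ^ i..<2 * 2 ^ i})" using i by auto
  qed
  have "half_sum c T z a b = (\<Sum>m\<in>Ms. f b' m)"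
    unfolding half_sum_def Ms_def[symmetric] f_def by (intro sum.cong refl) (simp add: b'_def)
  also have "\<dots> = (\<Sum>m\<in>(\<Union>i\<in>I. {2 ^ i..<2 * 2 ^ i}). f b' m)"
    using sub \<open>finite I\<close> by (intro sum.mono_neutral_left) (auto simp: f_def b'_def)
  also have "\<dots> = (\<Sum>i\<in>I. \<Sum>m\<in>{2 ^ i..<2 * 2 ^ i}. f b' m)"
  proof (intro sum.UNION_disjoint ballI impI)
    have disj: "{2 ^ i..<2 * 2 ^ i} \<inter> {2 ^ j..<2 * 2 ^ j} = ({}::nat set)" if "i < j" for i j :: nat
    proof -
      have "(2::nat) ^ Suc i \<le> 2 ^ j" using that by (intro power_increasing) auto
      then show ?thesis by auto
    qed
    fix i j :: nat assume "i \<noteq> j"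
    then show "{2 ^ i..<2 * 2 ^ i} \<inter> {2 ^ j..<2 * 2 ^ j} = ({}::nat set)"
      using disj[of i j] disj[of j i] by (cases "i < j") (auto simp: Int_commute)
  qed (use \<open>finite I\<close> in auto)
  finally have "norm (half_sum c T z a b) \<le> (\<Sum>i\<in>I. norm (\<Sum>m\<in>{2 ^ i..<2 * 2 ^ i}. f b' m))"
    by (simp add: norm_sum)
  also have "\<dots> \<le> (\<Sum>i\<in>I. (2 * T) powr c * (19 * T * ln T / real (2 ^ i) powr (1 / 4)))"
  proof (intro sum_mono)
    fix i assume "i \<in> I"
    then show "norm (\<Sum>m\<in>{2 ^ i..<2 * 2 ^ i}. f b' m) \<le> (2 * T) powr c * (19 * T * ln T / real (2 ^ i) powr (1 / 4))"
      unfolding f_def using assms by (intro weighted_dyadic_bilinear_le) (auto simp: I_def b'_def)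
  qed
  also have "\<dots> = (2 * T) powr c * (19 * T * ln T) * (\<Sum>i\<in>I. 1 / (2 ^ i) powr (1 / 4))"
    by (simp add: sum_distrib_left)
  also have "\<dots> \<le> (2 * T) powr c * (19 * T * ln T) * (16 / z powr (1 / 4))"
    using \<open>finite I\<close> assms by (intro mult_left_mono sum_dyadic_powr_le) (auto simp: I_def)
  \<comment> \<open>The constant is 19 from a block times 16 from the geometric series.\<close>
  also have "\<dots> = 304 * 2 powr c * (T powr (1 + c) * ln T / z powr (1 / 4))"
    using assms(2) by (simp add: powr_mult powr_add)
  finally show ?thesis .
qed

text \<open>Bookkeeping that turns a sum over a finite set of pairs into \<open>half_sum\<close>,
  provided the coefficients kill every term outside that set. The swap reflects that
  \<open>half_sum\<close> has \<open>m\<close> as its outer variable.\<close>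

lemma sum_eq_half_sum:
  fixes g :: "nat \<times> nat \<Rightarrow> complex"
  assumes "finite D"
    and D: "\<And>n m. (n, m) \<in> D \<Longrightarrow> z < real m \<and> real m ^ 2 \<le> T \<and> n \<ge> 1 \<and> real n * real m \<le> T"
    and g: "\<And>n m. z < real m \<Longrightarrow> real m ^ 2 \<le> T \<Longrightarrow> n \<ge> 1 \<Longrightarrow> real n * real m \<le> T \<Longrightarrow>
      of_real ((real n * real m) powr c) * a n * b m * of_real (jacobi_sqfree n m) = (if (n, m) \<in> D then g (n, m) else 0)"
    and "z \<ge> 0"
  shows "(\<Sum>p\<in>D. g p) = half_sum c T z a b"
proof -
  define Ms where "Ms = {m. z < real m \<and> real m ^ 2 \<le> T}"
  define Ns where "Ns m = {n. n \<ge> 1 \<and> real m * real n \<le> T}" for m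
  have "finite Ms"
  proof (rule finite_subset[OF _ finite_nat_real_le[of T]], rule subsetI)
    fix m assume "m \<in> Ms"
    then show "m \<in> {n. real n \<le> T}" using real_le_square[of m] unfolding Ms_def mem_Collect_eq by linarith
  qed
  have "finite (Ns m)" if "m \<in> Ms" for m
  proof (rule finite_subset[OF _ finite_nat_real_le[of T]], rule subsetI)
    fix n assume "n \<in> Ns m"
    have "1 \<le> m" using that assms(4) by (cases m) (auto simp: Ms_def)
    then have "1 * real n \<le> real m * real n" by (intro mult_right_mono) auto
    moreover have "real m * real n \<le> T" using \<open>n \<in> Ns m\<close> by (simp add: Ns_def)
    ultimately show "n \<in> {n. real n \<le> T}" unfolding mem_Collect_eq by linarith
  qed
  then have "half_sum c T z a b = (\<Sum>(m, n)\<in>Sigma Ms Ns.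
     of_real ((real n * real m) powr c) * a n * b m * of_real (jacobi_sqfree n m))"
    unfolding half_sum_def Ms_def[symmetric] Ns_def[symmetric] using \<open>finite Ms\<close> by (intro sum.Sigma) auto
  also have "\<dots> = (\<Sum>p\<in>Sigma Ms Ns. if prod.swap p \<in> D then g (prod.swap p) else 0)"
  proof (intro sum.cong refl)
    fix p assume "p \<in> Sigma Ms Ns"
    then obtain m n where p: "p = (m, n)" and "z < real m" "real m ^ 2 \<le> T" "n \<ge> 1" "real n * real m \<le> T"
      by (auto simp: Ms_def Ns_def mult.commute)
    then show "(case p of (m, n) \<Rightarrow>
        of_real ((real n * real m) powr c) * a n * b m * of_real (jacobi_sqfree n m)) =
        (if prod.swap p \<in> D then g (prod.swap p) else 0)"
      unfolding p prod.case swap_simp by (intro g)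
  qed
  also have "\<dots> = (\<Sum>p\<in>{p\<in>Sigma Ms Ns. prod.swap p \<in> D}. g (prod.swap p))"
    using \<open>finite Ms\<close> \<open>\<And>m. m \<in> Ms \<Longrightarrow> finite (Ns m)\<close> by (intro sum.inter_filter[symmetric]) auto
  also have "\<dots> = (\<Sum>p\<in>D. g p)"
    by (rule sum.reindex_bij_witness[of _ prod.swap prod.swap])
       (auto dest: D simp: Ms_def Ns_def mult.commute)
  finally show ?thesis ..
qed

theorem theorem1p4:
  fixes c :: real
  assumes "c \<ge> 0"
  shows "\<exists>C::real. \<forall>(T::real) (z::real) (a :: nat \<Rightarrow> complex) (b :: nat \<Rightarrow> complex).
           T \<ge> 2 \<longrightarrow> z \<ge> 2 \<longrightarrow> (\<forall>n\<ge>1. norm (a n) \<le> 1) \<longrightarrow> (\<forall>m\<ge>1. norm (b m) \<le> 1) \<longrightarrow>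
           norm (\<Sum>(n, m)\<in>odd_squarefree_pairs T z.
                   of_real ((real n * real m) powr c) * a n * b m * of_int (jacobi (int n) m))
             \<le> C * (T powr (1 + c) * ln T / z powr (1 / 4))"
proof (intro exI allI impI)
  fix T z :: real and a b :: "nat \<Rightarrow> complex"
  assume T: "T \<ge> 2" and z: "z \<ge> 2" and a: "\<forall>n\<ge>1. norm (a n) \<le> 1" and b: "\<forall>m\<ge>1. norm (b m) \<le> 1"
  define Q where "Q = odd_squarefree_pairs T z"
  define g where "g = (\<lambda>(n, m). of_real ((real n * real m) powr c) * a n * b m * of_int (jacobi (int n) m))"
  \<comment> \<open>Pairs with small \<open>m\<close> are treated directly; for the others the roles
    of \<open>n\<close> and \<open>m\<close> are exchanged by reciprocity.\<close>
  define Q1 where "Q1 = {(n, m)\<in>Q. real m ^ 2 \<le> T}"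
  define Q2 where "Q2 = {(n, m)\<in>Q. \<not> real m ^ 2 \<le> T}"
  define R where "R = 304 * 2 powr c * (T powr (1 + c) * ln T / z powr (1 / 4))"
  define ok where "ok n \<longleftrightarrow> odd n \<and> squarefree n \<and> z < real n" for n :: nat
  have ok_pos: "n \<ge> 1" if "ok n" for n using that by (cases n) (auto simp: ok_def)
  have Q_iff: "(n, m) \<in> Q \<longleftrightarrow> ok n \<and> ok m \<and> real n * real m \<le> T" for n m
  proof
    assume nm: "ok n \<and> ok m \<and> real n * real m \<le> T"
    then have "1 \<le> n" "1 \<le> m" using ok_pos by auto
    then have "real n * 1 \<le> real n * real m" "1 * real m \<le> real n * real m"
      by (intro mult_left_mono mult_right_mono; simp)+
    then have "real n \<le> T" "real m \<le> T" using nm by linarith+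
    with nm show "(n, m) \<in> Q" by (simp add: Q_def odd_squarefree_pairs_def ok_def)
  qed (auto simp: Q_def odd_squarefree_pairs_def ok_def)
  have "finite Q"
  proof (rule finite_subset)
    show "Q \<subseteq> {n. real n \<le> T} \<times> {n. real n \<le> T}" by (auto simp: Q_def odd_squarefree_pairs_def)
  qed (intro finite_cartesian_product finite_nat_real_le)
  then have fin: "finite Q1" "finite Q2" "finite (prod.swap ` Q2)"
    by (auto simp: Q1_def Q2_def intro: finite_subset)
  have split: "(\<Sum>p\<in>Q. g p) = (\<Sum>p\<in>Q1. g p) + (\<Sum>p\<in>Q2. g p)"
    using fin by (subst sum.union_disjoint[symmetric]) (auto simp: Q1_def Q2_def intro: sum.cong)

  define a1 where "a1 n = (if ok n then a n else 0)" for n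
  have "(\<Sum>p\<in>Q1. g p) = half_sum c T z a1 b"
    using z fin(1) ok_pos by (intro sum_eq_half_sum)
      (auto simp: Q1_def Q_iff ok_def a1_def g_def jacobi_sqfree_def)
  also have "norm \<dots> \<le> R"
    unfolding R_def using assms T z a b by (intro norm_half_sum_le) (auto simp: a1_def)
  finally have R1: "norm (\<Sum>p\<in>Q1. g p) \<le> R" .

  \<comment> \<open>On odd numbers this is the nontrivial character modulo 4.\<close>
  define \<chi> where "\<chi> n = (if n mod 4 = 3 then -1 else 1 :: complex)" for n :: nat
  \<comment> \<open>The coefficient carries the condition that \<open>m\<close> exceeds the square
    root of \<open>T\<close>, so pairs already counted in \<open>Q1\<close> do not reappear after
    the exchange.\<close>
  define a2 where "a2 m = (if ok m \<and> \<not> real m ^ 2 \<le> T then b m else 0)" for m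
  define a2' where "a2' m = \<chi> m * a2 m" for m
  define a' where "a' n = \<chi> n * a n" for n
  define h where "h u v = (\<lambda>(m, n). of_real ((real m * real n) powr c) * u m * v n * of_int (jacobi (int m) n) :: complex)"
    for u v :: "nat \<Rightarrow> complex"
  have h_sum: "(\<Sum>p\<in>prod.swap ` Q2. h u v p) = half_sum c T z u v"
    if "\<And>m. \<not> (ok m \<and> \<not> real m ^ 2 \<le> T) \<Longrightarrow> u m = 0" for u v
  proof (rule sum_eq_half_sum)
    fix m n assume "(m, n) \<in> prod.swap ` Q2"
    then have mn: "ok n" "ok m" "real n * real m \<le> T" "T < real m ^ 2" by (auto simp: Q2_def Q_iff)
    \<comment> \<open>If \<open>n\<close> were larger than \<open>m\<close>, then
      \<open>m\<^sup>2 \<le> n * m \<le> T\<close>, contrary to the definition of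
      \<open>Q2\<close>.\<close>
    have "real n ^ 2 \<le> T"
    proof (cases "n \<le> m")
      case True
      then have "real n * real n \<le> real n * real m" by (intro mult_left_mono) auto
      then show ?thesis using mn(3) by (simp add: power2_eq_square)
    next
      case False
      then have "real m * real m \<le> real n * real m" by (intro mult_right_mono) auto
      then show ?thesis using mn(3,4) by (simp add: power2_eq_square)
    qed
    then show "z < real n \<and> real n ^ 2 \<le> T \<and> m \<ge> 1 \<and> real m * real n \<le> T"
      using mn ok_pos by (auto simp: ok_def mult.commute)
  next
    fix m n assume "z < real n" "real m * real n \<le> T"
    have "(m, n) \<in> prod.swap ` Q2 \<longleftrightarrow> ok m \<and> ok n \<and> real m * real n \<le> T \<and> \<not> real m ^ 2 \<le> T"
      by (auto simp: Q2_def Q_iff image_iff mult.commute)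
    then show "of_real ((real m * real n) powr c) * u m * v n * of_real (jacobi_sqfree m n) =
      (if (m, n) \<in> prod.swap ` Q2 then h u v (m, n) else 0)"
      using that[of m] \<open>z < real n\<close> \<open>real m * real n \<le> T\<close> by (auto simp: h_def jacobi_sqfree_def ok_def)
  qed (use z fin in auto)
  have "(\<Sum>p\<in>Q2. g p) = (\<Sum>p\<in>prod.swap ` Q2. (h a2 a p + h a2' a p + h a2 a' p - h a2' a' p) / 2)"
  proof (subst sum.reindex)
    show "(\<Sum>p\<in>Q2. g p) = (\<Sum>p\<in>Q2. ((\<lambda>p. (h a2 a p + h a2' a p + h a2 a' p - h a2' a' p) / 2) \<circ> prod.swap) p)"
    proof (intro sum.cong refl)
      fix p assume "p \<in> Q2"
      then obtain n m where p: "p = (n, m)" and nm: "ok n" "ok m" "\<not> real m ^ 2 \<le> T"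
        by (auto simp: Q2_def Q_iff)
      \<comment> \<open>This separates the variables: the reciprocity sign becomes a combination of
        four products of a function of \<open>m\<close> and a function of \<open>n\<close>, each of
        modulus 1.\<close>
      have "complex_of_int (recip_sign n m) = (1 + \<chi> m + \<chi> n - \<chi> m * \<chi> n) / 2"
        by (auto simp: recip_sign_def \<chi>_def)
      moreover have "jacobi (int n) m = recip_sign n m * jacobi (int m) n"
        using nm by (intro jacobi_recip) (auto simp: ok_def)
      moreover define w where "w = of_real ((real m * real n) powr c) * a n * b m * of_int (jacobi (int m) n)"
      ultimately have "g p = (1 + \<chi> m + \<chi> n - \<chi> m * \<chi> n) / 2 * w"
        by (simp add: p g_def mult_ac)
      also have "\<dots> = (w + \<chi> m * w + \<chi> n * w - \<chi> m * \<chi> n * w) / 2"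
        by (simp add: algebra_simps)
      finally show "g p = ((\<lambda>p. (h a2 a p + h a2' a p + h a2 a' p - h a2' a' p) / 2) \<circ> prod.swap) p"
        using nm by (simp add: p w_def h_def a2_def a2'_def a'_def mult_ac)
    qed
  qed simp
  also have "\<dots> = (half_sum c T z a2 a + half_sum c T z a2' a + half_sum c T z a2 a' - half_sum c T z a2' a') / 2"
    by (simp add: sum_divide_distrib[symmetric] sum.distrib sum_subtractf h_sum a2_def a2'_def)
  also have "norm \<dots> \<le> (R + R + R + R) / 2"
  proof -
    have bounds: "norm (a2 n) \<le> 1" "norm (a2' n) \<le> 1" "norm (a' n) \<le> 1" if "n \<ge> 1" for n
      using that a b by (auto simp: a2_def a2'_def a'_def \<chi>_def norm_mult)
    have "norm (half_sum c T z a2 a) \<le> R" "norm (half_sum c T z a2' a) \<le> R"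
      "norm (half_sum c T z a2 a') \<le> R" "norm (half_sum c T z a2' a') \<le> R"
      unfolding R_def using assms T z a bounds by (intro norm_half_sum_le; simp)+
    then have "norm (half_sum c T z a2 a + half_sum c T z a2' a + half_sum c T z a2 a' - half_sum c T z a2' a') \<le> R + R + R + R"
      by (intro order.trans[OF norm_triangle_ineq4] add_mono order.trans[OF norm_triangle_ineq])
    then show ?thesis by (simp add: norm_divide)
  qed
  \<comment> \<open>Four half sums, each at most \<open>R\<close>, are halved. With
    \<open>Q1\<close> the total is \<open>3 * R\<close>, and 3 * 304 = 912.\<close>
  finally have R2: "norm (\<Sum>p\<in>Q2. g p) \<le> 2 * R" by simp
  have "norm (\<Sum>p\<in>Q. g p) \<le> R + 2 * R"
    unfolding split by (intro order.trans[OF norm_triangle_ineq] add_mono R1 R2)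
  then show "norm (\<Sum>(n, m)\<in>odd_squarefree_pairs T z.
      of_real ((real n * real m) powr c) * a n * b m * of_int (jacobi (int n) m))
    \<le> (912 * 2 powr c) * (T powr (1 + c) * ln T / z powr (1 / 4))"
  proof -
    have "R + 2 * R = (912 * 2 powr c) * (T powr (1 + c) * ln T / z powr (1 / 4))"
      by (simp add: R_def)
    with \<open>norm (\<Sum>p\<in>Q. g p) \<le> R + 2 * R\<close> show ?thesis
      by (simp only: Q_def g_def case_prod_unfold)
  qed
qed

end
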